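(* Let $G$ be a countable amenable group acting on a dendrite $X$, and suppose that $K\subseteq X$ is a minimal set for the action. Then the restricted action $(K,G)$ is equicontinuous, and $K$ is either finite or homeomorphic to the Cantor set.
   Context: A continuum is a non-empty connected compact metric space. An arc is a continuum homeomorphic to $[0,1]$. A continuum $X$ is uniquely arcwise connected if for any two points $x\neq y$ in $X$ there is a unique arc in $X$ connecting $x$ and $y$. A dendrite is a locally connected, uniquely arcwise connected continuum. An action of a group $G$ on a compact metric space $X$ is a group homomorphism $\phi:G\to \mathrm{Homeo}(X)$, where $\mathrm{Homeo}(X)$ is the homeomorphism group of $X$; write $gx=g(x)=\phi(g)(x)$ and $Gx=\{gx : g\in G\}$. A subset $A\subseteq X$ is $G$-invariant if $\bigcup_{x\in A}Gx=A$. A minimal set for the action is a non-empty closed $G$-invariant subset $K\subseteq X$ such that $\overline{Gx}=K$ for every $x\in K$. For such $K$, $(K,G)$ denotes the action of $G$ restricted to $K$. A countable group $G$ is amenable if there is a sequence of (non-empty) finite sets $F_i\subseteq G$ ($i=1,2,3,\dots$) such that $\lim_{i\to\infty} |gF_i\bigtriangleup F_i|/|F_i|=0$ for every $g\in G$, where $|F|$ denotes the number of elements of $F$. An action $(Y,G)$ on a compact metric space $(Y,d)$ is equicontinuous if for every $\epsilon>0$ there is a $\delta>0$ such that $d(gx,gy)<\epsilon$ for all $g\in G$ whenever $x,y\in Y$ satisfy $d(x,y)<\delta$. *)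

theory Defs
  imports "HOL-Analysis.Analysis" "HOL-Algebra.Group_Action"
begin

definition continuum :: "'a::metric_space set \<Rightarrow> bool" where
  "continuum X \<longleftrightarrow> X \<noteq> {} \<and> connected X \<and> compact X"

text \<open>
  In a Hausdorff space an injective path is a homeomorphism onto its image, so the images of
  the paths satisfying \<^const>\<open>arc\<close> are exactly the subspaces homeomorphic to $[0,1]$.
  Uniqueness is that of the image, not of the parametrization; \<open>A\<close> connects \<open>x\<close> and \<open>y\<close>
  if these are its two end points.
\<close>

definition arc_between :: "'a::topological_space \<Rightarrow> 'a \<Rightarrow> 'a set \<Rightarrow> bool" where
  "arc_between x y A \<longleftrightarrow> (\<exists>p. arc p \<and> path_image p = A \<and> pathstart p = x \<and> pathfinish p = y)"

definition uniquely_arcwise_connected :: "'a::topological_space set \<Rightarrow> bool" where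
  "uniquely_arcwise_connected X \<longleftrightarrow>
     (\<forall>x\<in>X. \<forall>y\<in>X. x \<noteq> y \<longrightarrow> (\<exists>!A. A \<subseteq> X \<and> arc_between x y A))"

definition dendrite :: "'a::metric_space set \<Rightarrow> bool" where
  "dendrite X \<longleftrightarrow> continuum X \<and> locally connected X \<and> uniquely_arcwise_connected X"

text \<open>
  As for \<^const>\<open>BijGroup\<close>, the elements are extensional functions, i.e. they are
  \<^const>\<open>undefined\<close> outside of \<open>X\<close>, so that each self-homeomorphism is represented once.
\<close>

definition Homeo :: "'a::topological_space set \<Rightarrow> ('a \<Rightarrow> 'a) monoid" where
  "Homeo X = (BijGroup X)\<lparr>carrier := {f \<in> extensional X. \<exists>f'. homeomorphism X X f f'}\<rparr>"

definition homeo_action ::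
    "('g, 'm) monoid_scheme \<Rightarrow> 'a::topological_space set \<Rightarrow> ('g \<Rightarrow> 'a \<Rightarrow> 'a) \<Rightarrow> bool" where
  "homeo_action G X \<phi> \<longleftrightarrow> \<phi> \<in> hom G (Homeo X)"

definition invariant_set ::
    "('g, 'm) monoid_scheme \<Rightarrow> ('g \<Rightarrow> 'a \<Rightarrow> 'a) \<Rightarrow> 'a set \<Rightarrow> bool" where
  "invariant_set G \<phi> A \<longleftrightarrow> (\<Union>x\<in>A. orbit G \<phi> x) = A"

definition minimal_set ::
    "('g, 'm) monoid_scheme \<Rightarrow> 'a::topological_space set \<Rightarrow> ('g \<Rightarrow> 'a \<Rightarrow> 'a) \<Rightarrow> 'a set \<Rightarrow> bool"
  where
  "minimal_set G X \<phi> K \<longleftrightarrow>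
     K \<noteq> {} \<and> closedin (top_of_set X) K \<and> invariant_set G \<phi> K \<and>
     (\<forall>x\<in>K. top_of_set X closure_of orbit G \<phi> x = K)"

definition restrict_action :: "('g \<Rightarrow> 'a \<Rightarrow> 'a) \<Rightarrow> 'a set \<Rightarrow> 'g \<Rightarrow> 'a \<Rightarrow> 'a" where
  "restrict_action \<phi> K g = restrict (\<phi> g) K"

definition amenable :: "('g, 'm) monoid_scheme \<Rightarrow> bool" where
  "amenable G \<longleftrightarrow>
     (\<exists>F :: nat \<Rightarrow> 'g set.
        (\<forall>i. finite (F i) \<and> F i \<noteq> {} \<and> F i \<subseteq> carrier G) \<and>
        (\<forall>g\<in>carrier G.
           (\<lambda>i. real (card (sym_diff (g <#\<^bsub>G\<^esub> F i) (F i))) / real (card (F i))) \<longlonglongrightarrow> 0))"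

definition equicontinuous_action ::
    "('g, 'm) monoid_scheme \<Rightarrow> 'a::metric_space set \<Rightarrow> ('g \<Rightarrow> 'a \<Rightarrow> 'a) \<Rightarrow> bool" where
  "equicontinuous_action G Y \<psi> \<longleftrightarrow>
     (\<forall>\<epsilon>>0. \<exists>\<delta>>0. \<forall>x\<in>Y. \<forall>y\<in>Y. dist x y < \<delta> \<longrightarrow>
        (\<forall>g\<in>carrier G. dist (\<psi> g x) (\<psi> g y) < \<epsilon>))"

text \<open>
  The middle-thirds set. Each stage consists of two copies of the previous one, scaled by $1/3$.
\<close>

primrec cantor_stage :: "nat \<Rightarrow> real set" where
  "cantor_stage 0 = {0..1}"
| "cantor_stage (Suc n) =
     (\<lambda>x. x / 3) ` cantor_stage n \<union> (\<lambda>x. (x + 2) / 3) ` cantor_stage n"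

definition cantor_set :: "real set" where
  "cantor_set = (\<Inter>n. cantor_stage n)"


text \<open>\<^const>\<open>Homeo\<close> is a group, and an action restricts to an action on every invariant subset.\<close>

lemma subgroup_Homeo:
  "subgroup {f \<in> extensional X. \<exists>f'. homeomorphism X X f f'} (BijGroup X)"
proof -
  interpret group "BijGroup X" by (rule group_BijGroup)
  let ?H = "{f \<in> extensional X. \<exists>f'. homeomorphism X X f f'}"
  have sub: "?H \<subseteq> Bij X"
    by (auto simp: Bij_def bij_betw_def homeomorphism_def inj_on_def) (metis)
  have mult: "f \<otimes>\<^bsub>BijGroup X\<^esub> g = compose X f g" if "f \<in> ?H" "g \<in> ?H" for f g
    using sub that by (auto simp: BijGroup_def)
  have cong: "homeomorphism X X f' g" if "homeomorphism X X f g" "\<And>x. x \<in> X \<Longrightarrow> f' x = f x"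
    for f f' g :: "'a \<Rightarrow> 'a"
    using homeomorphism_cong[OF that(1) refl refl] that(2) by auto
  show ?thesis
  proof
    show "?H \<subseteq> carrier (BijGroup X)"
      using sub by (simp add: BijGroup_def)
    show "\<one>\<^bsub>BijGroup X\<^esub> \<in> ?H"
      using cong[OF homeomorphism_ident[of X], of "\<lambda>x\<in>X. x"] by (auto simp: BijGroup_def)
  next
    fix f g assume fg: "f \<in> ?H" "g \<in> ?H"
    then obtain f' g' where h: "homeomorphism X X f f'" "homeomorphism X X g g'" by blast
    have "homeomorphism X X (compose X f g) (g' \<circ> f')"
      by (rule cong[OF homeomorphism_compose[OF h(2) h(1)]]) (simp add: compose_def)
    then show "f \<otimes>\<^bsub>BijGroup X\<^esub> g \<in> ?H"
      unfolding mult[OF fg] by (auto simp: compose_def)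
  next
    fix f assume f: "f \<in> ?H"
    then obtain f' where h: "homeomorphism X X f f'" by blast
    have inv: "inv\<^bsub>BijGroup X\<^esub> f = (\<lambda>x\<in>X. inv_into X f x)"
      using f sub by (intro inv_BijGroup) auto
    have "inj_on f X"
      using f sub by (auto simp: Bij_def bij_betw_def)
    then have "inv_into X f x = f' x" if "x \<in> X" for x
      using h that by (metis homeomorphism_def imageI inv_into_f_f)
    then have "homeomorphism X X (\<lambda>x\<in>X. inv_into X f x) f"
      by (intro cong[OF homeomorphism_symD[OF h]]) auto
    then show "inv\<^bsub>BijGroup X\<^esub> f \<in> ?H"
      unfolding inv by auto
  qed
qed

lemma group_Homeo: "group (Homeo X)"
  using subgroup.subgroup_is_group[OF subgroup_Homeo group_BijGroup]
  by (simp add: Homeo_def)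

lemma homeo_action_restrict_action:
  assumes "group G" "homeo_action G X \<phi>" "K \<subseteq> X" "invariant_set G \<phi> K"
  shows "homeo_action G K (restrict_action \<phi> K)"
proof -
  interpret G: group G by fact
  interpret group_hom G "Homeo X" \<phi>
    using assms group_Homeo by (auto simp: group_hom_def group_hom_axioms_def homeo_action_def)
  have mem: "\<phi> g x \<in> K" if "g \<in> carrier G" "x \<in> K" for g x
    using assms(4) that by (auto simp: invariant_set_def orbit_def)
  have bij: "\<phi> g \<in> Bij X" if "g \<in> carrier G" for g
    using hom_closed[OF that] subgroup.subset[OF subgroup_Homeo, of X]
    by (auto simp: Homeo_def BijGroup_def)
  have mult: "\<phi> (g \<otimes>\<^bsub>G\<^esub> h) x = \<phi> g (\<phi> h x)"
    if "g \<in> carrier G" "h \<in> carrier G" "x \<in> X" for g h x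
    using hom_mult[OF that(1,2)] bij that by (simp add: Homeo_def BijGroup_def compose_def)
  have one: "\<phi> \<one>\<^bsub>G\<^esub> x = x" if "x \<in> X" for x
    using hom_one that by (simp add: Homeo_def BijGroup_def)
  have cont: "continuous_on K (\<phi> g)" if "g \<in> carrier G" for g
    using hom_closed[OF that] assms(3)
    by (auto simp: Homeo_def homeomorphism_def intro: continuous_on_subset)
  have homeo: "homeomorphism K K (restrict_action \<phi> K g) (\<phi> (inv\<^bsub>G\<^esub> g))"
    if g: "g \<in> carrier G" for g
  proof (rule homeomorphismI)
    show "continuous_on K (restrict_action \<phi> K g)"
      using cont[OF g] by (simp add: restrict_action_def cong: continuous_on_cong)
    show "continuous_on K (\<phi> (inv\<^bsub>G\<^esub> g))"
      by (rule cont) (use g in simp)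
    show "restrict_action \<phi> K g ` K \<subseteq> K" "\<phi> (inv\<^bsub>G\<^esub> g) ` K \<subseteq> K"
      using mem[OF g] mem[OF G.inv_closed[OF g]]
      by (auto simp: restrict_action_def simp del: hom_inv)
    show "\<phi> (inv\<^bsub>G\<^esub> g) (restrict_action \<phi> K g x) = x" if "x \<in> K" for x
      using mult[of "inv\<^bsub>G\<^esub> g" g x] one[of x] g that assms(3)
      by (auto simp: restrict_action_def simp del: hom_inv)
    show "restrict_action \<phi> K g (\<phi> (inv\<^bsub>G\<^esub> g) x) = x" if "x \<in> K" for x
      using mult[of g "inv\<^bsub>G\<^esub> g" x] one[of x] g that assms(3) mem[of "inv\<^bsub>G\<^esub> g" x]
      by (auto simp: restrict_action_def simp del: hom_inv)
  qed
  have carr: "restrict_action \<phi> K g \<in> {f \<in> extensional K. \<exists>f'. homeomorphism K K f f'}"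
    if "g \<in> carrier G" for g
    using homeo[OF that] by (auto simp: restrict_action_def)
  have bijK: "restrict_action \<phi> K g \<in> Bij K" if "g \<in> carrier G" for g
    using carr[OF that] subgroup.subset[OF subgroup_Homeo, of K] by (auto simp: BijGroup_def)
  have "restrict_action \<phi> K (g \<otimes>\<^bsub>G\<^esub> h) =
        compose K (restrict_action \<phi> K g) (restrict_action \<phi> K h)"
    if "g \<in> carrier G" "h \<in> carrier G" for g h
    using mult[OF that] mem[OF that(2)] assms(3)
    by (auto simp: restrict_action_def compose_def fun_eq_iff)
  then show ?thesis
    using carr bijK by (auto simp: homeo_action_def hom_def Homeo_def BijGroup_def)
qed

end

theory Submission
  imports Defs
begin

text \<open>
  A \<^emph>\<open>branch\<close> of the dendrite \<open>X\<close> at a point \<open>c\<close> is a component of \<open>X - {c}\<close>. Branches are open, a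
  homeomorphism permutes them, and any two points of \<open>X\<close> lie in different branches at some third
  point. The proof compares the size of branches with respect to the metric and with respect to
  the group.

  Amenability gives a submeasure on the subsets of \<open>K\<close> that is invariant under the action: the
  upper density, along a Foelner sequence, of the times at which the orbit of a fixed point visits
  a set (lemma \<open>amenable_imp_invariant_submeasure\<close>). It need not be additive, but \<open>n\<close> disjoint translates
  of one set have size at most \<open>1/n\<close> each. As every orbit in \<open>K\<close> is dense, every open set that meets
  \<open>K\<close> has positive mass.

  \<^item> A branch of small mass meets \<open>K\<close> in a set of small diameter (\<open>small_mass_imp_small_branch\<close>).
    Otherwise there are branches of mass tending to \<open>0\<close> that contain pairs of points of \<open>K\<close> tending
    to \<open>a \<noteq> b\<close>. Let \<open>m\<close> separate \<open>a\<close> from \<open>b\<close>. A connected set that has points near \<open>a\<close> and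
    near \<open>b\<close> contains \<open>m\<close>, and a branch containing \<open>m\<close> also contains all but at most one of the
    branches at \<open>m\<close>. So its mass is at least that of the branch of \<open>a\<close> or of \<open>b\<close> at \<open>m\<close>.

  \<^item> If \<open>K\<close> is infinite, every point of \<open>K\<close> lies in branches of arbitrarily small mass
    (\<open>branch_of_small_mass\<close>). Some \<open>e \<in> K\<close> is an end point with respect to \<open>K\<close>, so that branches
    form a base of its neighbourhoods in \<open>K\<close>. Since the orbit of \<open>e\<close> is infinite, a small ball at \<open>e\<close>
    has many disjoint translates, so it has small mass. A translate of a branch at \<open>e\<close> reaches any
    other point of \<open>K\<close>, again because orbits are dense.

  A finite \<open>K\<close> is equicontinuous because its points are separated. Otherwise branches of small mass
  cover \<open>K\<close>, and all their translates have the same mass and therefore small diameter in \<open>K\<close>: this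
  is equicontinuity. It also follows that a point separating two points of \<open>K\<close> is never in \<open>K\<close>,
  so that branches cut \<open>K\<close> into relatively clopen pieces, and \<open>K\<close> is totally disconnected. An
  infinite minimal set has no isolated points, so \<open>K\<close> is a Cantor set by Brouwer's
  characterization (\<open>homeomorphic_cantor_set\<close>).

  The separation of points rests on the theorem of Mazurkiewicz and Moore that connected open
  subsets of \<open>X\<close> are path connected: if an inner point of the arc from \<open>x\<close> to \<open>y\<close> did not separate
  \<open>x\<close> from \<open>y\<close>, there would be a second arc avoiding it.
\<close>

section \<open>Paths in locally connected compact spaces\<close>

text \<open>
  The points that can be reached from \<open>x\<close> by a chain of small connected open sets form a clopen
  subset of \<open>V\<close>. A chain can be prolonged by repeating its last link, and this is why every
  sufficiently large length \<open>M\<close> occurs: it makes it possible to refine all links of a chain by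
  the same factor.
\<close>

lemma reachable_by_small_connected_sets:
  fixes X :: "'a::metric_space set"
  assumes X: "compact X" "locally connected X"
    and V: "openin (top_of_set X) V" "connected V" and xy: "x \<in> V" "y \<in> V" and "0 < \<epsilon>"
  shows "\<exists>n. \<forall>M\<ge>n. \<exists>q W. q 0 = x \<and> q M = y \<and>
     (\<forall>r<M. openin (top_of_set X) (W r) \<and> connected (W r) \<and> closure (W r) \<subseteq> V \<and>
       (\<forall>u\<in>W r. \<forall>v\<in>W r. dist u v < \<epsilon>) \<and> q r \<in> W r \<and> q (Suc r) \<in> W r)"
proof -
  define small where "small W \<longleftrightarrow> openin (top_of_set X) W \<and> connected W \<and> closure W \<subseteq> V \<and>
       (\<forall>u\<in>W. \<forall>v\<in>W. dist u v < \<epsilon>)" for W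
  define R where "R u v \<longleftrightarrow> (\<exists>W. small W \<and> u \<in> W \<and> v \<in> W)" for u v
  have small_ex: "\<exists>W. small W \<and> u \<in> W" if "u \<in> V" for u
  proof -
    obtain T where T: "open T" "V = X \<inter> T"
      using V(1) by (auto simp: openin_open)
    with that obtain e where e: "e > 0" "cball u e \<subseteq> T"
      by (metis IntD2 open_contains_cball)
    define d where "d = min e (\<epsilon> / 3)"
    have d: "d > 0" "cball u d \<subseteq> T" "d \<le> \<epsilon> / 3"
      using e \<open>0 < \<epsilon>\<close> by (auto simp: d_def)
    have "openin (top_of_set X) (X \<inter> ball u d)" "u \<in> X \<inter> ball u d"
      using that T d by auto
    then obtain W where W: "openin (top_of_set X) W" "connected W" "u \<in> W" "W \<subseteq> X \<inter> ball u d"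
      using X(2) unfolding locally_connected by meson
    have "closure W \<subseteq> X \<inter> cball u d"
      using W(4) compact_imp_closed[OF X(1)]
      by (intro closure_minimal) (auto intro: less_imp_le)
    moreover have "dist v w < \<epsilon>" if "v \<in> W" "w \<in> W" for v w
    proof -
      have "dist u v < d" "dist u w < d"
        using W(4) that by auto
      moreover have "dist v w \<le> dist u v + dist u w"
        by (metis dist_commute dist_triangle)
      ultimately show ?thesis
        using d(3) \<open>0 < \<epsilon>\<close> by linarith
    qed
    ultimately have "small W"
      using W T(2) d(2) by (auto simp: small_def)
    with W(3) show ?thesis by blast
  qed
  have R_V: "v \<in> V" if "R u v" for u v
    using that closure_subset by (fastforce simp: R_def small_def)
  have "R\<^sup>*\<^sup>* x y"
  proof -
    define A where "A = {v \<in> V. R\<^sup>*\<^sup>* x v}"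
    have step: "W \<subseteq> V" "openin (top_of_set V) W" if "small W" for W
    proof -
      show "W \<subseteq> V"
        using that closure_subset by (fastforce simp: small_def)
      then show "openin (top_of_set V) W"
        using that V(1) by (metis openin_imp_subset openin_subset_trans small_def)
    qed
    have "openin (top_of_set V) A"
    proof (subst openin_subopen, intro ballI)
      fix v assume v: "v \<in> A"
      then obtain W where W: "small W" "v \<in> W"
        using small_ex by (auto simp: A_def)
      have "W \<subseteq> A"
      proof
        fix w assume "w \<in> W"
        with W have "R v w" by (auto simp: R_def)
        with v have "R\<^sup>*\<^sup>* x w"
          unfolding A_def by (metis (mono_tags, lifting) mem_Collect_eq rtranclp.rtrancl_into_rtrancl)
        with step[OF W(1)] \<open>w \<in> W\<close> show "w \<in> A" by (auto simp: A_def)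
      qed
      with step[OF W(1)] W show "\<exists>T. openin (top_of_set V) T \<and> v \<in> T \<and> T \<subseteq> A" by blast
    qed
    moreover have "openin (top_of_set V) (V - A)"
    proof (subst openin_subopen, intro ballI)
      fix v assume v: "v \<in> V - A"
      then obtain W where W: "small W" "v \<in> W"
        using small_ex by auto
      have "W \<subseteq> V - A"
      proof
        fix w assume w: "w \<in> W"
        with W have "R w v" by (auto simp: R_def)
        with v have "\<not> R\<^sup>*\<^sup>* x w"
          by (metis (mono_tags, lifting) A_def DiffD1 DiffD2 mem_Collect_eq
              rtranclp.rtrancl_into_rtrancl)
        with step[OF W(1)] w show "w \<in> V - A" by (auto simp: A_def)
      qed
      with step[OF W(1)] W show "\<exists>T. openin (top_of_set V) T \<and> v \<in> T \<and> T \<subseteq> V - A" by blast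
    qed
    then have "closedin (top_of_set V) A"
      by (auto simp: closedin_def A_def)
    moreover have "x \<in> A" using xy by (simp add: A_def)
    ultimately have "A = V"
      using V(2) by (auto simp: connected_clopen)
    with xy show ?thesis by (auto simp: A_def)
  qed
  then obtain n where n: "(R ^^ n) x y"
    using rtranclp_imp_relpowp by fast
  show ?thesis
  proof (rule exI[of _ n], intro allI impI)
    fix M assume "n \<le> M"
    have "R y y" using small_ex[OF xy(2)] by (auto simp: R_def)
    then have "(R ^^ k) y y" for k
      by (induction k) auto
    with n have "(R ^^ (n + (M - n))) x y"
      by (metis relcomppI relpowp_add)
    then have "(R ^^ M) x y" using \<open>n \<le> M\<close> by simp
    then obtain q where q: "q 0 = x" "q M = y" "\<forall>i<M. R (q i) (q (Suc i))"
      unfolding relpowp_fun_conv by blast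
    then have "\<forall>i. \<exists>W. i < M \<longrightarrow> small W \<and> q i \<in> W \<and> q (Suc i) \<in> W"
      unfolding R_def by blast
    then obtain W where "\<And>i. i < M \<Longrightarrow> small (W i) \<and> q i \<in> W i \<and> q (Suc i) \<in> W i"
      by metis
    with q(1,2) show "\<exists>q W. q 0 = x \<and> q M = y \<and>
     (\<forall>r<M. openin (top_of_set X) (W r) \<and> connected (W r) \<and> closure (W r) \<subseteq> V \<and>
       (\<forall>u\<in>W r. \<forall>v\<in>W r. dist u v < \<epsilon>) \<and> q r \<in> W r \<and> q (Suc r) \<in> W r)"
      unfolding small_def by blast
  qed
qed

text \<open>
  The last link \<open>V N\<close> has no successor and only carries the end point of the chain. It makes it
  possible to index the chain by \<open>\<lfloor>N * t\<rfloor>\<close> for all \<open>t\<close> in \<open>[0,1]\<close>, including \<open>t = 1\<close>.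
\<close>

definition connected_chain :: "'a::metric_space set \<Rightarrow> nat \<Rightarrow> (nat \<Rightarrow> 'a) \<Rightarrow> (nat \<Rightarrow> 'a set) \<Rightarrow> bool"
  where "connected_chain X N p V \<longleftrightarrow> 0 < N \<and>
     (\<forall>j\<le>N. openin (top_of_set X) (V j) \<and> connected (V j) \<and> p j \<in> V j) \<and>
     (\<forall>j<N. p (Suc j) \<in> V j)"

text \<open>
  Inside every link \<open>V j\<close>, the points \<open>p j\<close> and \<open>p (j + 1)\<close> are joined by a chain of \<open>M\<close> small links.
  As \<open>M\<close> does not depend on \<open>j\<close>, the new link \<open>j * M + r\<close> lies in the old link \<open>j\<close>.
\<close>

lemma connected_chain_refine:
  fixes X :: "'a::metric_space set"
  assumes X: "compact X" "locally connected X" and ch: "connected_chain X N p V" and "0 < \<epsilon>"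
  shows "\<exists>M p' V'. 0 < M \<and> connected_chain X (N * M) p' V' \<and> p' 0 = p 0 \<and> p' (N * M) = p N \<and>
     (\<forall>j\<le>N * M. closure (V' j) \<subseteq> V (j div M) \<and> (\<forall>u\<in>V' j. \<forall>v\<in>V' j. dist u v < \<epsilon>))"
proof -
  define t where "t j = (if j < N then p (Suc j) else p N)" for j
  define L where "L j M q W \<longleftrightarrow> q 0 = p j \<and> q M = t j \<and>
     (\<forall>r<M. openin (top_of_set X) (W r) \<and> connected (W r) \<and> closure (W r) \<subseteq> V j \<and>
       (\<forall>u\<in>W r. \<forall>v\<in>W r. dist u v < \<epsilon>) \<and> q r \<in> W r \<and> q (Suc r) \<in> W r)"
    for j M and q :: "nat \<Rightarrow> 'a" and W
  have "\<exists>n. \<forall>M\<ge>n. \<exists>q W. L j M q W" if "j \<le> N" for j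
    unfolding L_def using ch \<open>0 < \<epsilon>\<close> that
    by (intro reachable_by_small_connected_sets[OF X]) (auto simp: connected_chain_def t_def)
  then obtain n where n: "\<And>j M. j \<le> N \<Longrightarrow> M \<ge> n j \<Longrightarrow> \<exists>q W. L j M q W"
    by metis
  define M where "M = Suc (\<Sum>j\<le>N. n j)"
  have "n j \<le> M" if "j \<le> N" for j
    using that by (simp add: M_def le_SucI member_le_sum)
  with n have "\<forall>j\<in>{..N}. \<exists>q W. L j M q W"
    by simp
  then obtain q where "\<forall>j\<in>{..N}. \<exists>W. L j M (q j) W"
    by (rule bchoice[THEN exE])
  then obtain W where "\<forall>j\<in>{..N}. L j M (q j) (W j)"
    by (rule bchoice[THEN exE])
  then have L: "L j M (q j) (W j)" if "j \<le> N" for j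
    using that by simp
  have q: "q j 0 = p j \<and> q j M = t j" if "j \<le> N" for j
    using L[OF that] by (simp add: L_def)
  have W: "openin (top_of_set X) (W j r) \<and> connected (W j r) \<and>
        closure (W j r) \<subseteq> V j \<and> (\<forall>u\<in>W j r. \<forall>v\<in>W j r. dist u v < \<epsilon>) \<and>
        q j r \<in> W j r \<and> q j (Suc r) \<in> W j r" if "j \<le> N" "r < M" for j r
    using L[OF that(1)] that(2) unfolding L_def by blast
  have M: "0 < M" by (simp add: M_def)
  have le: "i div M \<le> N" "i mod M < M" if "i \<le> N * M" for i
    using div_le_mono[OF that, of M] M by simp_all
  define p' where "p' i = q (i div M) (i mod M)" for i
  define V' where "V' i = W (i div M) (i mod M)" for i
  have nxt: "p' (Suc i) \<in> V' i" if i: "i < N * M" for i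
  proof -
    have in_link: "q (i div M) (Suc (i mod M)) \<in> V' i"
      unfolding V'_def using W[OF le] i by simp
    show ?thesis
    proof (cases "Suc (i mod M) = M")
      case True
      have dN: "i div M < N"
        using i M by (simp add: less_mult_imp_div_less)
      have m0: "Suc i mod M = 0"
        unfolding mod_Suc by (rule if_P[OF True])
      then have "Suc i div M = Suc (i div M)"
        unfolding div_Suc by (rule if_P)
      with m0 have "p' (Suc i) = q (Suc (i div M)) 0"
        by (simp only: p'_def)
      also have "\<dots> = q (i div M) M"
        using q[of "Suc (i div M)"] q[of "i div M"] dN by (simp add: t_def)
      also have "\<dots> \<in> V' i"
        using in_link unfolding True .
      finally show ?thesis .
    next
      case False
      then have m0: "Suc i mod M = Suc (i mod M)"
        unfolding mod_Suc by (rule if_not_P)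
      then have "Suc i div M = i div M"
        unfolding div_Suc by (intro if_not_P) simp
      with m0 have "p' (Suc i) = q (i div M) (Suc (i mod M))"
        by (simp only: p'_def)
      with in_link show ?thesis by simp
    qed
  qed
  have "connected_chain X (N * M) p' V'"
    using W[OF le] nxt M ch unfolding connected_chain_def p'_def V'_def by simp
  moreover have "p' 0 = p 0" "p' (N * M) = p N"
    using q[of 0] q[of N] M by (auto simp: p'_def)
  moreover have "closure (V' j) \<subseteq> V (j div M) \<and> (\<forall>u\<in>V' j. \<forall>v\<in>V' j. dist u v < \<epsilon>)"
    if "j \<le> N * M" for j
    using W[OF le[OF that]] by (simp add: V'_def)
  ultimately show ?thesis
    using M by blast
qed

text \<open>
  Refining a chain from \<open>a\<close> to \<open>b\<close> again and again, with links of diameter below \<open>1/k\<close> at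
  stage \<open>k\<close>, gives for each \<open>t\<close> in \<open>[0,1]\<close> a nested sequence of links, those with index \<open>\<lfloor>N k * t\<rfloor>\<close>.
  Compactness yields a point \<open>f t\<close> in their intersection. Parameters closer than \<open>1 / N k\<close>
  belong to equal or adjacent links of stage \<open>k\<close>, so \<open>f\<close> is continuous.
\<close>

theorem open_connected_imp_path_connected:
  fixes X :: "'a::metric_space set"
  assumes X: "compact X" "locally connected X"
    and U: "openin (top_of_set X) U" "connected U"
  shows "path_connected U"
  unfolding path_connected_def
proof (intro ballI)
  fix a b assume ab: "a \<in> U" "b \<in> U"
  define P where "P k s \<longleftrightarrow> (case s of (N, p, V) \<Rightarrow> connected_chain X N p V \<and> p 0 = a \<and> p N = b \<and>
      (\<forall>j\<le>N. V j \<subseteq> U) \<and> (0 < k \<longrightarrow> (\<forall>j\<le>N. \<forall>u\<in>V j. \<forall>v\<in>V j. dist u v < 1 / real k)))"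
    for k and s :: "nat \<times> (nat \<Rightarrow> 'a) \<times> (nat \<Rightarrow> 'a set)"
  define Q where "Q s s' \<longleftrightarrow> (case (s, s') of ((N, p, V), (N', p', V')) \<Rightarrow>
      \<exists>M>0. N' = N * M \<and> (\<forall>j\<le>N'. closure (V' j) \<subseteq> V (j div M)))"
    for s s' :: "nat \<times> (nat \<Rightarrow> 'a) \<times> (nat \<Rightarrow> 'a set)"
  have P0: "P 0 (1, \<lambda>j. if j = 0 then a else b, \<lambda>j. U)"
    using ab U by (auto simp: P_def connected_chain_def)
  have PS: "\<exists>s'. P (Suc k) s' \<and> Q s s'" if "P k s" for k s
  proof -
    obtain N p V where s: "s = (N, p, V)" by (cases s) auto
    with that have ch: "connected_chain X N p V" "p 0 = a" "p N = b" "\<forall>j\<le>N. V j \<subseteq> U"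
      by (auto simp: P_def)
    obtain M p' V' where 1: "0 < M" "connected_chain X (N * M) p' V'" "p' 0 = a" "p' (N * M) = b"
      and 2: "\<And>j. j\<le>N * M \<Longrightarrow> closure (V' j) \<subseteq> V (j div M)"
      and 3: "\<forall>j\<le>N * M. \<forall>u\<in>V' j. \<forall>v\<in>V' j. dist u v < 1 / real (Suc k)"
      using connected_chain_refine[OF X ch(1), of "1 / real (Suc k)"] ch(2,3)
      by auto
    have "V' j \<subseteq> U" if "j \<le> N * M" for j
    proof -
      have "j div M \<le> N" using that 1(1) by (metis div_le_mono div_mult_self_is_m)
      then show ?thesis using 2[OF that] closure_subset[of "V' j"] ch(4) by blast
    qed
    then have "P (Suc k) (N * M, p', V')"
      using 1 3 by (auto simp: P_def)
    moreover have "Q s (N * M, p', V')"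
      using 1 2 by (auto simp: Q_def s)
    ultimately show ?thesis by blast
  qed
  obtain s where s: "\<And>k. P k (s k)" "\<And>k. Q (s k) (s (Suc k))"
    using dependent_nat_choice[of P "\<lambda>_. Q"] P0 PS by metis
  define N where "N k = fst (s k)" for k
  define V where "V k = snd (snd (s k))" for k
  define p where "p k = fst (snd (s k))" for k
  have sk: "s k = (N k, p k, V k)" for k by (simp add: N_def V_def p_def)
  have ch: "connected_chain X (N k) (p k) (V k)" and p0: "p k 0 = a" and pN: "p k (N k) = b"
    and VU: "\<And>j. j \<le> N k \<Longrightarrow> V k j \<subseteq> U" for k
    using s(1)[of k] by (auto simp: P_def sk)
  have small: "dist u v < 1 / real k" if "0 < k" "j \<le> N k" "u \<in> V k j" "v \<in> V k j" for k j u v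
    using s(1)[of k] that by (auto simp: P_def sk)
  have N0: "0 < N k" for k using ch by (simp add: connected_chain_def)
  define i where "i k t = nat \<lfloor>real (N k) * t\<rfloor>" for k t
  have iN: "i k t \<le> N k" if "t \<in> {0..1}" for k t
  proof -
    have "real (N k) * t \<le> real (N k)" using that by (simp add: mult_left_le)
    then show ?thesis unfolding i_def
      by (metis floor_mono floor_of_nat nat_int nat_mono)
  qed
  have nest: "closure (V (Suc k) (i (Suc k) t)) \<subseteq> V k (i k t)" if "t \<in> {0..1}" for k t
  proof -
    obtain M where M: "M > 0" "N (Suc k) = N k * M"
      "\<forall>j\<le>N (Suc k). closure (V (Suc k) j) \<subseteq> V k (j div M)"
      using s(2)[of k] by (auto simp: Q_def sk)
    have "real (N (Suc k)) * t / real M = real (N k) * t"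
      using M by simp
    then have "\<lfloor>real (N k) * t\<rfloor> = \<lfloor>real (N (Suc k)) * t\<rfloor> div int M"
      by (metis floor_divide_real_eq_div of_nat_0_le_iff of_int_of_nat_eq)
    then have "i (Suc k) t div M = i k t"
      unfolding i_def using that by (simp add: nat_div_distrib)
    with M(3) iN[OF that, of "Suc k"] show ?thesis by metis
  qed
  have ne: "V k (i k t) \<noteq> {}" if "t \<in> {0..1}" for k t
    using ch[of k] iN[OF that, of k] by (auto simp: connected_chain_def)
  have anti: "V l (i l t) \<subseteq> V k (i k t)" if "k \<le> l" "t \<in> {0..1}" for k l t
    using that(1)
  proof (induction rule: dec_induct)
    case (step n)
    then show ?case using nest[OF that(2), of n] closure_subset by blast
  qed simp
  have "\<exists>x. \<forall>k. x \<in> V k (i k t)" if t: "t \<in> {0..1}" for t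
  proof -
    have "X \<inter> (\<Inter>k\<in>UNIV. closure (V (Suc k) (i (Suc k) t))) \<noteq> {}"
    proof (rule compact_imp_fip_image[OF X(1)])
      fix J :: "nat set" assume J: "finite J"
      obtain l where l: "\<And>k. k \<in> J \<Longrightarrow> k \<le> l"
        using finite_nat_set_iff_bounded_le J by meson
      obtain x where x: "x \<in> V (Suc l) (i (Suc l) t)"
        using ne[OF t, of "Suc l"] by blast
      have "x \<in> X" using x ch[of "Suc l"] iN[OF t, of "Suc l"] openin_imp_subset
        by (fastforce simp: connected_chain_def)
      moreover have "x \<in> closure (V (Suc k) (i (Suc k) t))" if "k \<in> J" for k
        using anti[of "Suc k" "Suc l" t] l[OF that] x t closure_subset by blast
      ultimately show "X \<inter> (\<Inter>k\<in>J. closure (V (Suc k) (i (Suc k) t))) \<noteq> {}" by blast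
    qed auto
    then show ?thesis using nest[OF t] by blast
  qed
  then obtain f where f: "\<And>t k. t \<in> {0..1} \<Longrightarrow> f t \<in> V k (i k t)" by metis
  have uniq: "x = y" if "\<And>k. \<exists>j\<le>N k. x \<in> V k j \<and> y \<in> V k j" for x y
  proof (rule ccontr)
    assume "x \<noteq> y"
    then obtain k where k: "0 < k" "1 / real k < dist x y"
      by (metis dist_pos_lt nat_approx_posE of_nat_0_less_iff zero_less_Suc)
    with that[of k] small[of k] show False by fastforce
  qed
  have near: "dist (f t) (f t') < 2 / real k"
    if t: "t \<in> {0..1}" "t' \<in> {0..1}" and k: "0 < k" and d: "t \<le> t'" "t' - t < 1 / real (N k)" for t t' k
  proof -
    have "real (N k) * t' < real (N k) * t + 1"
      using d N0[of k] by (simp add: field_simps)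
    then have "\<lfloor>real (N k) * t'\<rfloor> \<le> \<lfloor>real (N k) * t\<rfloor> + 1" by linarith
    moreover have "\<lfloor>real (N k) * t\<rfloor> \<le> \<lfloor>real (N k) * t'\<rfloor>"
      using d by (intro floor_mono mult_left_mono) auto
    moreover have "0 \<le> \<lfloor>real (N k) * t\<rfloor>" using t by simp
    ultimately have "i k t' = i k t \<or> i k t' = Suc (i k t)" unfolding i_def by linarith
    then obtain z where z: "z \<in> V k (i k t)" "z \<in> V k (i k t')"
    proof
      assume "i k t' = i k t" then show thesis using f[OF t(1), of k] that by metis
    next
      assume *: "i k t' = Suc (i k t)"
      with iN[OF t(2), of k] have "i k t < N k" by simp
      then have "p k (Suc (i k t)) \<in> V k (i k t)" "p k (Suc (i k t)) \<in> V k (Suc (i k t))"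
        using ch[of k] by (auto simp: connected_chain_def)
      with * show thesis using that by metis
    qed
    have "dist (f t) z < 1 / real k" "dist z (f t') < 1 / real k"
      using small[OF k] iN t f z by blast+
    then show ?thesis
      using dist_triangle[of "f t" "f t'" z] by simp
  qed
  have "continuous_on {0..1} f"
    unfolding continuous_on_iff
  proof (intro ballI allI impI)
    fix t e :: real assume t: "t \<in> {0..1}" and "0 < e"
    then obtain k where k: "0 < k" "2 / real k < e"
      by (metis nat_approx_posE half_gt_zero_iff less_divide_eq_numeral1(1) mult.commute
          times_divide_eq_right mult_1_right zero_less_Suc)
    show "\<exists>d>0. \<forall>x'\<in>{0..1}. dist x' t < d \<longrightarrow> dist (f x') (f t) < e"
    proof (intro exI[of _ "1 / real (N k)"] conjI ballI impI)
      show "0 < 1 / real (N k)" using N0 by simp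
      fix t' assume t': "t' \<in> {0..1}" "dist t' t < 1 / real (N k)"
      have "dist (f t') (f t) < 2 / real k"
      proof (cases "t \<le> t'")
        case True
        with near[OF t t'(1) k(1)] t'(2) show ?thesis by (simp add: dist_real_def dist_commute)
      next
        case False
        with near[OF t'(1) t k(1)] t'(2) show ?thesis by (simp add: dist_real_def)
      qed
      with k show "dist (f t') (f t) < e" by simp
    qed
  qed
  then have "path f" by (simp add: path_def)
  moreover have "path_image f \<subseteq> U"
    using f[of _ 0] VU[of _ 0] iN[of _ 0] by (fastforce simp: path_image_def)
  moreover have "f 0 = a"
  proof (rule uniq)
    fix k
    have "a \<in> V k 0" using ch[of k] p0[of k] by (metis connected_chain_def le0)
    then show "\<exists>j\<le>N k. f 0 \<in> V k j \<and> a \<in> V k j"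
      using f[of 0 k] by (intro exI[of _ 0]) (auto simp: i_def)
  qed
  moreover have "f 1 = b"
  proof (rule uniq)
    fix k
    have "b \<in> V k (N k)" using ch[of k] pN[of k] by (metis connected_chain_def order_refl)
    then show "\<exists>j\<le>N k. f 1 \<in> V k j \<and> b \<in> V k j"
      using f[of 1 k] by (intro exI[of _ "N k"]) (auto simp: i_def)
  qed
  ultimately show "\<exists>g. path g \<and> path_image g \<subseteq> U \<and> pathstart g = a \<and> pathfinish g = b"
    by (auto simp: pathstart_def pathfinish_def)
qed

section \<open>Arcs in metric spaces\<close>

text \<open>
  The Kuratowski embedding. Subtracting the distance to a base point makes the distance functions
  bounded on unbounded spaces.
\<close>

lemma isometric_embedding_bcontfun:
  obtains emb :: "'a::metric_space \<Rightarrow> 'a \<Rightarrow>\<^sub>C real" where "\<And>x y. dist (emb x) (emb y) = dist x y"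
proof -
  define x0 :: 'a where "x0 = undefined"
  define emb where "emb x = Bcontfun (\<lambda>z. dist x z - dist x0 z)" for x
  have bc: "(\<lambda>z. dist x z - dist x0 z) \<in> bcontfun" for x
    unfolding bcontfun_def mem_Collect_eq
  proof
    show "continuous_on UNIV (\<lambda>z. dist x z - dist x0 z)"
      by (intro continuous_intros)
    show "bounded (range (\<lambda>z. dist x z - dist x0 z))"
      unfolding bounded_iff
      using abs_dist_diff_le[of x _ x0]
      by (intro exI[of _ "dist x x0"]) (auto simp: dist_commute)
  qed
  then have app: "apply_bcontfun (emb x) z = dist x z - dist x0 z" for x z
    by (simp add: emb_def Bcontfun_inverse)
  have "dist (emb x) (emb y) = dist x y" for x y
  proof (rule antisym)
    show "dist (emb x) (emb y) \<le> dist x y"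
      using abs_dist_diff_le[of x _ y]
      by (intro dist_bound) (simp add: app dist_real_def dist_commute)
    show "dist x y \<le> dist (emb x) (emb y)"
      using dist_bounded[of "emb x" y "emb y"] by (simp add: app dist_real_def)
  qed
  then show thesis by (rule that)
qed

text \<open>
  The corresponding fact \<open>path_contains_arc\<close> for complete normed spaces carries over along an
  isometric embedding.
\<close>

lemma path_contains_arc_metric:
  fixes p :: "real \<Rightarrow> 'a::metric_space"
  assumes "path p" and ab: "pathstart p \<noteq> pathfinish p"
  obtains q where "arc q" "path_image q \<subseteq> path_image p"
    "pathstart q = pathstart p" "pathfinish q = pathfinish p"
proof -
  obtain emb :: "'a \<Rightarrow> 'a \<Rightarrow>\<^sub>C real" where iso: "\<And>x y. dist (emb x) (emb y) = dist x y"
    using isometric_embedding_bcontfun by blast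
  have inj: "inj emb"
    by (rule injI) (metis iso dist_eq_0_iff)
  have cont: "continuous_on S emb" for S
    unfolding continuous_on_iff by (auto simp: iso)
  have continv: "continuous_on (range emb) (inv_into UNIV emb)"
    unfolding continuous_on_iff by (auto simp: iso inj)
  have "path (emb \<circ> p)"
    using \<open>path p\<close> cont by (rule path_continuous_image)
  then obtain q where q: "arc q" "path_image q \<subseteq> path_image (emb \<circ> p)"
    "pathstart q = emb (pathstart p)" "pathfinish q = emb (pathfinish p)"
  proof (rule path_contains_arc)
    show "pathstart (emb \<circ> p) = emb (pathstart p)" "pathfinish (emb \<circ> p) = emb (pathfinish p)"
      by (simp_all add: pathstart_compose pathfinish_compose)
    show "emb (pathstart p) \<noteq> emb (pathfinish p)"
      using ab inj by (simp add: inj_eq)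
  qed
  have sub: "path_image q \<subseteq> range emb"
    using q(2) by (auto simp: path_image_compose)
  have "path (inv_into UNIV emb \<circ> q)"
    using q(1) by (intro path_continuous_image continuous_on_subset[OF continv sub] arc_imp_path)
  moreover have "inj_on (inv_into UNIV emb \<circ> q) {0..1}"
    using q(1) sub by (intro comp_inj_on inj_on_inv_into) (auto simp: arc_def path_image_def)
  ultimately have "arc (inv_into UNIV emb \<circ> q)" by (simp add: arc_def)
  moreover have "path_image (inv_into UNIV emb \<circ> q) \<subseteq> path_image p"
    using q(2) inj by (fastforce simp: path_image_compose)
  moreover have "pathstart (inv_into UNIV emb \<circ> q) = pathstart p"
    "pathfinish (inv_into UNIV emb \<circ> q) = pathfinish p"
    using q(3,4) inj by (simp_all add: pathstart_compose pathfinish_compose)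
  ultimately show thesis by (rule that)
qed

section \<open>Branches of a dendrite\<close>

locale dendrite_space =
  fixes X :: "'a::metric_space set"
  assumes dendrite: "dendrite X"
begin

abbreviation branch :: "'a \<Rightarrow> 'a \<Rightarrow> 'a set"
  where "branch c x \<equiv> connected_component_set (X - {c}) x"

definition branches :: "'a set set"
  where "branches = (\<Union>c\<in>X. components (X - {c}))"

lemma compact_X: "compact X" and connected_X: "connected X" and locally_connected_X: "locally connected X"
  using dendrite by (auto simp: dendrite_def continuum_def)

lemma branches_iff: "H \<in> branches \<longleftrightarrow> (\<exists>c\<in>X. \<exists>x\<in>X - {c}. H = branch c x)"
  by (auto simp: branches_def components_def)

lemma branch_in_branches: "c \<in> X \<Longrightarrow> x \<in> X - {c} \<Longrightarrow> branch c x \<in> branches"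
  unfolding branches_iff by blast

lemma branch_subset: "branch c x \<subseteq> X - {c}"
  by (rule connected_component_subset)

lemma openin_branch: "openin (top_of_set X) (branch c x)"
proof (cases "x \<in> X - {c}")
  case True
  with locally_connected_2[OF locally_connected_X openin_delete[OF openin_subtopology_self]]
  show ?thesis by simp
next
  case False
  then show ?thesis by (metis connected_component_eq_empty openin_empty)
qed

lemma openin_branches: "H \<in> branches \<Longrightarrow> openin (top_of_set X) H"
  unfolding branches_iff using openin_branch by blast

lemma branch_self: "x \<in> X - {c} \<Longrightarrow> x \<in> branch c x"
  by simp

lemma branch_eq: "y \<in> branch c x \<Longrightarrow> branch c y = branch c x"
  by (rule connected_component_eq)

text \<open>
  The complement is the union of the other branches at \<open>c\<close>, which are open.
\<close>

lemma closed_insert_branch: "closed (insert c (branch c x))" if "c \<in> X"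
proof -
  have "X - insert c (branch c x) = (\<Union>y\<in>X - insert c (branch c x). branch c y)"
  proof
    show "X - insert c (branch c x) \<subseteq> (\<Union>y\<in>X - insert c (branch c x). branch c y)"
      using branch_self by blast
    show "(\<Union>y\<in>X - insert c (branch c x). branch c y) \<subseteq> X - insert c (branch c x)"
      using branch_subset connected_component_disjoint[of "X - {c}"] by blast
  qed
  also have "openin (top_of_set X) \<dots>"
    using openin_branch by blast
  finally have "closedin (top_of_set X) (insert c (branch c x))"
    using that branch_subset by (auto simp: closedin_def)
  then show ?thesis
    using compact_X compact_imp_closed closedin_closed_trans by blast
qed

text \<open>
  If \<open>c\<close> were not in the closure of the branch, the branch would be clopen in the connected space \<open>X\<close>.
\<close>

lemma connected_insert_branch: "connected (insert c (branch c x))" if c: "c \<in> X" and x: "x \<in> X - {c}"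
proof -
  have "c \<in> closure (branch c x)"
  proof (rule ccontr)
    assume "c \<notin> closure (branch c x)"
    moreover have "closure (branch c x) \<subseteq> insert c (branch c x)"
      by (intro closure_minimal closed_insert_branch c) auto
    ultimately have "closure (branch c x) \<subseteq> branch c x" by blast
    then have "closed (branch c x)" by (metis closure_subset_eq)
    then have "closedin (top_of_set X) (branch c x)"
      using branch_subset by (intro closed_subset) auto
    with openin_branch connected_X have "branch c x = {} \<or> branch c x = X"
      unfolding connected_clopen by blast
    with branch_subset[of c x] branch_self[OF x] c show False by blast
  qed
  then show ?thesis
    using closure_subset[of "branch c x"]
    by (intro connected_intermediate_closure[OF connected_connected_component[of "X - {c}" x]]) blast+
qed

text \<open>
  The only branch at \<open>m\<close> that can fail to lie in a given branch at \<open>c\<close> around \<open>m\<close> is the one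
  towards \<open>c\<close>.
\<close>

lemma branch_absorbs_branch:
  assumes "m \<in> branch c x" "a \<in> X - {m}" "c \<notin> branch m a"
  shows "insert m (branch m a) \<subseteq> branch c x"
proof -
  have "m \<in> X - {c}" using assms(1) branch_subset by blast
  then have "insert m (branch m a) \<subseteq> branch c m"
    using assms(2,3) branch_subset[of m a]
    by (intro connected_component_maximal connected_insert_branch) auto
  with branch_eq[OF assms(1)] show ?thesis by simp
qed

lemma connected_meets_cut_point:
  assumes "connected H" "H \<subseteq> X" "u \<in> H" "w \<in> H" "u \<in> branch m a" "w \<notin> branch m a"
  shows "m \<in> H"
proof (rule ccontr)
  assume "m \<notin> H"
  with assms(1-3) have "H \<subseteq> branch m u"
    by (intro connected_component_maximal) auto
  with assms branch_eq[OF assms(5)] show False by blast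
qed

text \<open>
  Uniqueness of arcs turns into separation: a branch at an inner point \<open>\<gamma> t\<close> that contained both
  ends would be connected and open, hence contain an arc between them that misses \<open>\<gamma> t\<close>.
\<close>

lemma separating_arc:
  assumes "x \<in> X" "y \<in> X" "x \<noteq> y"
  obtains \<gamma> where "arc \<gamma>" "path_image \<gamma> \<subseteq> X" "pathstart \<gamma> = x" "pathfinish \<gamma> = y"
    "\<And>t. t \<in> {0<..<1} \<Longrightarrow> \<gamma> t \<in> X - {x, y} \<and> y \<notin> branch (\<gamma> t) x"
proof -
  have ex1: "\<exists>!A. A \<subseteq> X \<and> arc_between x y A"
    using dendrite assms by (auto simp: dendrite_def uniquely_arcwise_connected_def)
  then obtain \<gamma> where \<gamma>: "arc \<gamma>" "path_image \<gamma> \<subseteq> X" "pathstart \<gamma> = x" "pathfinish \<gamma> = y"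
    unfolding arc_between_def by blast
  have "\<gamma> t \<in> X - {x, y} \<and> y \<notin> branch (\<gamma> t) x" if t: "t \<in> {0<..<1}" for t
  proof
    have "inj_on \<gamma> {0..1}" using \<gamma>(1) by (simp add: arc_def)
    then have "\<gamma> t \<noteq> \<gamma> 0" "\<gamma> t \<noteq> \<gamma> 1"
      using t by (auto simp: inj_on_eq_iff)
    then show mem: "\<gamma> t \<in> X - {x, y}"
      using \<gamma> t by (auto simp: pathstart_def pathfinish_def path_image_def)
    show "y \<notin> branch (\<gamma> t) x"
    proof
      assume y: "y \<in> branch (\<gamma> t) x"
      have "path_connected (branch (\<gamma> t) x)"
        using compact_X locally_connected_X openin_branch connected_connected_component
        by (rule open_connected_imp_path_connected)
      moreover have "x \<in> branch (\<gamma> t) x" using mem assms(1) by auto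
      ultimately obtain p where "path p" "path_image p \<subseteq> branch (\<gamma> t) x"
        "pathstart p = x" "pathfinish p = y"
        using y unfolding path_connected_def by blast
      then obtain q where "arc q" "path_image q \<subseteq> branch (\<gamma> t) x" "pathstart q = x" "pathfinish q = y"
        using path_contains_arc_metric[of p] assms(3) by (metis order_trans)
      then have "path_image q = path_image \<gamma>"
        using ex1 \<gamma> branch_subset[of "\<gamma> t" x] unfolding arc_between_def by blast
      moreover have "\<gamma> t \<in> path_image \<gamma>" using t by (auto simp: path_image_def)
      ultimately show False
        using \<open>path_image q \<subseteq> branch (\<gamma> t) x\<close> branch_subset by blast
    qed
  qed
  with \<gamma> show thesis by (intro that)
qed

lemma cut_point_between:
  assumes "x \<in> X" "y \<in> X" "x \<noteq> y"
  obtains m where "m \<in> X - {x, y}" "y \<notin> branch m x"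
  using separating_arc[OF assms] by (metis dense greaterThanLessThan_iff zero_less_one)

end

text \<open>
  Seen from a root \<open>c\<close>, the condition \<open>y \<notin> branch x c\<close> says that \<open>y\<close> lies beyond \<open>x\<close> or equals it. This
  lemma makes this relation a partial order.
\<close>

lemma (in dendrite_space) branch_nested:
  assumes "x \<in> X" "c \<in> X - {x}" "y \<notin> branch x c" "y \<noteq> x"
  shows "insert x (branch x c) \<subseteq> branch y c"
proof (rule connected_component_maximal)
  show "c \<in> insert x (branch x c)" using assms by simp
  show "connected (insert x (branch x c))" using assms by (intro connected_insert_branch)
  show "insert x (branch x c) \<subseteq> X - {y}" using assms branch_subset[of x c] by auto
qed

lemma (in dendrite_space) homeomorphism_image_branch:
  assumes h: "homeomorphism X X f f'" and c: "c \<in> X" and x: "x \<in> X - {c}"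
  shows "f ` branch c x = branch (f c) (f x)"
proof -
  have img: "k ` branch c x \<subseteq> branch (k c) (k x)"
    if k: "homeomorphism X X k k'" and c: "c \<in> X" and x: "x \<in> X - {c}" for k k' c x
  proof (rule connected_component_maximal)
    have inj: "inj_on k X" using k unfolding homeomorphism_def by (metis inj_on_inverseI)
    have sub: "branch c x \<subseteq> X - {c}" by (rule branch_subset)
    show "k x \<in> k ` branch c x" using x by simp
    show "connected (k ` branch c x)"
      using k sub
      by (intro connected_continuous_image connected_connected_component)
        (auto simp: homeomorphism_def intro: continuous_on_subset)
    show "k ` branch c x \<subseteq> X - {k c}"
    proof (rule image_subsetI)
      fix y assume "y \<in> branch c x"
      then have "y \<in> X" "y \<noteq> c" using sub by blast+
      then show "k y \<in> X - {k c}"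
        using k inj c by (auto simp: homeomorphism_def inj_on_eq_iff)
    qed
  qed
  have fx: "f c \<in> X" "f x \<in> X - {f c}"
    using h c x unfolding homeomorphism_def by (blast, metis DiffD1 DiffD2 DiffI image_eqI insertCI singletonD)
  have "f ` f' ` branch (f c) (f x) \<subseteq> f ` branch c x"
    using img[OF homeomorphism_symD[OF h] fx] h c x by (auto simp: homeomorphism_def)
  moreover have "f ` f' ` branch (f c) (f x) = branch (f c) (f x)"
  proof -
    have "f (f' y) = y" if "y \<in> branch (f c) (f x)" for y
      using h that branch_subset unfolding homeomorphism_def by blast
    then have "(\<lambda>y. f (f' y)) ` branch (f c) (f x) = (\<lambda>y. y) ` branch (f c) (f x)"
      by (intro image_cong refl)
    then show ?thesis unfolding image_image by simp
  qed
  ultimately show ?thesis using img[OF h c x] by blast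
qed

section \<open>Amenable groups\<close>

text \<open>
  Translation by \<open>g\<close> maps \<open>F \<inter> A\<close> onto \<open>gF \<inter> gA\<close>, and the latter differs from \<open>F \<inter> gA\<close> only
  within the symmetric difference of \<open>gF\<close> and \<open>F\<close>.
\<close>

lemma (in group) card_Int_l_coset_diff_le:
  assumes F: "finite F" "F \<subseteq> carrier G" and g: "g \<in> carrier G" and A: "A \<subseteq> carrier G"
  shows "\<bar>real (card (F \<inter> (g <#\<^bsub>G\<^esub> A))) - real (card (F \<inter> A))\<bar> \<le> real (card (sym_diff (g <#\<^bsub>G\<^esub> F) F))"
proof -
  have inj: "inj_on (\<lambda>h. g \<otimes> h) (carrier G)"
    using g by (auto simp: inj_on_def)
  have coset: "g <#\<^bsub>G\<^esub> B = (\<lambda>h. g \<otimes> h) ` B" for B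
    by (auto simp: l_coset_def)
  have "(g <#\<^bsub>G\<^esub> F) \<inter> (g <#\<^bsub>G\<^esub> A) = g <#\<^bsub>G\<^esub> (F \<inter> A)"
    unfolding coset using inj_on_image_Int[OF inj F(2) A] by simp
  moreover have "card (g <#\<^bsub>G\<^esub> (F \<inter> A)) = card (F \<inter> A)"
    unfolding coset using F(2) by (intro card_image inj_on_subset[OF inj]) auto
  ultimately have card_eq: "card ((g <#\<^bsub>G\<^esub> F) \<inter> (g <#\<^bsub>G\<^esub> A)) = card (F \<inter> A)" by simp
  have fin: "finite (g <#\<^bsub>G\<^esub> F)" unfolding coset using F(1) by simp
  have cmp: "card (B \<inter> A') \<le> card (C \<inter> A') + card (sym_diff (g <#\<^bsub>G\<^esub> F) F)"
    if "(B = F \<and> C = g <#\<^bsub>G\<^esub> F) \<or> (B = g <#\<^bsub>G\<^esub> F \<and> C = F)" for A' B C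
  proof -
    have "card (B \<inter> A') \<le> card ((C \<inter> A') \<union> (sym_diff (g <#\<^bsub>G\<^esub> F) F))"
      using that fin F(1) by (intro card_mono) auto
    also have "\<dots> \<le> card (C \<inter> A') + card (sym_diff (g <#\<^bsub>G\<^esub> F) F)"
      by (rule card_Un_le)
    finally show ?thesis .
  qed
  have "card (F \<inter> (g <#\<^bsub>G\<^esub> A)) \<le> card (F \<inter> A) + card (sym_diff (g <#\<^bsub>G\<^esub> F) F)"
    "card (F \<inter> A) \<le> card (F \<inter> (g <#\<^bsub>G\<^esub> A)) + card (sym_diff (g <#\<^bsub>G\<^esub> F) F)"
    using cmp[of F "g <#\<^bsub>G\<^esub> F" "g <#\<^bsub>G\<^esub> A"] cmp[of "g <#\<^bsub>G\<^esub> F" F "g <#\<^bsub>G\<^esub> A"] card_eq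
    by auto
  then show ?thesis by linarith
qed

text \<open>
  The upper density along a Foelner sequence. Being a limit superior it is only subadditive, but the
  densities of the translates of one set differ by null sequences. Therefore disjoint translates
  attain the upper density nearly simultaneously, which bounds it by the reciprocal of their number.
\<close>

theorem amenable_imp_invariant_submeasure:
  fixes G :: "('g, 'm) monoid_scheme"
  assumes G: "group G" and am: "amenable G"
  obtains \<nu> :: "'g set \<Rightarrow> real" where
    "\<nu> (carrier G) = 1"
    "\<And>A B. A \<subseteq> B \<Longrightarrow> \<nu> A \<le> \<nu> B"
    "\<And>A B. \<nu> (A \<union> B) \<le> \<nu> A + \<nu> B"
    "\<And>g A. \<lbrakk>g \<in> carrier G; A \<subseteq> carrier G\<rbrakk> \<Longrightarrow> \<nu> (g <#\<^bsub>G\<^esub> A) = \<nu> A"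
    "\<And>S A. \<lbrakk>finite S; S \<subseteq> carrier G; A \<subseteq> carrier G; disjoint_family_on (\<lambda>g. g <#\<^bsub>G\<^esub> A) S\<rbrakk>
        \<Longrightarrow> real (card S) * \<nu> A \<le> 1"
proof -
  interpret group G by fact
  obtain F where F: "\<And>i::nat. finite (F i)" "\<And>i. F i \<noteq> {}" "\<And>i. F i \<subseteq> carrier G"
    and lim: "\<And>g. g \<in> carrier G \<Longrightarrow>
      (\<lambda>i. real (card (sym_diff (g <#\<^bsub>G\<^esub> F i) (F i))) / real (card (F i))) \<longlonglongrightarrow> 0"
    using am unfolding amenable_def by blast
  have cF: "0 < card (F i)" for i using F by (simp add: card_gt_0_iff)
  define d where "d i A = real (card (F i \<inter> A)) / real (card (F i))" for i A
  have d0: "0 \<le> d i A" for i A by (simp add: d_def)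
  have d_mono: "d i A \<le> d i B" if "A \<subseteq> B" for i A B
    unfolding d_def using that F by (intro divide_right_mono) (auto intro!: card_mono)
  have dG: "d i (carrier G) = 1" for i
    using F(3)[of i] cF[of i] by (simp add: d_def Int_absorb2)
  have d1: "d i A \<le> 1" for i A
  proof -
    have "d i A \<le> d i UNIV" by (intro d_mono) simp
    then show ?thesis using cF[of i] by (simp add: d_def)
  qed
  have d_Un: "d i (A \<union> B) \<le> d i A + d i B" for i A B
    unfolding d_def add_divide_distrib[symmetric] Int_Un_distrib
    using card_Un_le[of "F i \<inter> A" "F i \<inter> B"] by (intro divide_right_mono) auto
  have d_inv: "(\<lambda>i. d i (g <#\<^bsub>G\<^esub> A) - d i A) \<longlonglongrightarrow> 0" if "g \<in> carrier G" "A \<subseteq> carrier G" for g A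
  proof (rule Lim_null_comparison[OF _ lim[OF that(1)]], intro always_eventually allI)
    fix i
    have "d i (g <#\<^bsub>G\<^esub> A) - d i A = (real (card (F i \<inter> (g <#\<^bsub>G\<^esub> A))) - real (card (F i \<inter> A))) / real (card (F i))"
      by (simp add: d_def diff_divide_distrib)
    then show "norm (d i (g <#\<^bsub>G\<^esub> A) - d i A) \<le> real (card (sym_diff (g <#\<^bsub>G\<^esub> F i) (F i))) / real (card (F i))"
      using card_Int_l_coset_diff_le[OF F(1,3) that, of i] by (simp add: divide_right_mono)
  qed
  define \<nu> where "\<nu> A = Inf {c. \<forall>\<^sub>F i in sequentially. d i A \<le> c}" for A
  have ne: "1 \<in> {c. \<forall>\<^sub>F i in sequentially. d i A \<le> c}" for A
    using d1 by simp
  have lower: "0 \<le> c" if c: "\<forall>\<^sub>F i in sequentially. d i A \<le> c" for c A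
    using eventually_happens[OF c] d0[of _ A] by (auto intro: order_trans)
  have bdd: "bdd_below {c. \<forall>\<^sub>F i in sequentially. d i A \<le> c}" for A
    using lower by (intro bdd_belowI[of _ 0]) auto
  have \<nu>_le: "\<nu> A \<le> c" if "\<forall>\<^sub>F i in sequentially. d i A \<le> c" for A c
    unfolding \<nu>_def using that by (intro cInf_lower bdd) auto
  have ev: "\<forall>\<^sub>F i in sequentially. d i A < c" if less: "\<nu> A < c" for A c
  proof -
    obtain c' where c': "\<forall>\<^sub>F i in sequentially. d i A \<le> c'" "c' < c"
      using less ne[of A] unfolding \<nu>_def by (metis (mono_tags, lifting) cInf_lessD empty_iff mem_Collect_eq)
    then show ?thesis by (auto elim: eventually_mono)
  qed
  have le: "\<nu> A \<le> \<nu> B" if "(\<lambda>i. d i A - d i B) \<longlonglongrightarrow> 0" for A B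
  proof (rule field_le_epsilon)
    fix e :: real assume e: "0 < e"
    have "\<forall>\<^sub>F i in sequentially. d i A - d i B < e / 2"
      using order_tendstoD(2)[OF that, of "e / 2"] e by simp
    moreover have "\<forall>\<^sub>F i in sequentially. d i B < \<nu> B + e / 2"
      using e by (intro ev) simp
    ultimately have "\<forall>\<^sub>F i in sequentially. d i A \<le> \<nu> B + e"
      by eventually_elim simp
    then show "\<nu> A \<le> \<nu> B + e" by (rule \<nu>_le)
  qed
  show thesis
  proof (rule that)
    show "\<nu> (carrier G) = 1"
    proof (rule antisym)
      show "\<nu> (carrier G) \<le> 1" using d1 by (intro \<nu>_le) simp
      show "1 \<le> \<nu> (carrier G)"
        using ev[of "carrier G" 1] by (auto simp: dG not_le[symmetric])
    qed
    show "\<nu> A \<le> \<nu> B" if "A \<subseteq> B" for A B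
    proof (rule field_le_epsilon)
      fix e :: real assume e: "0 < e"
      have "\<forall>\<^sub>F i in sequentially. d i B < \<nu> B + e" using e by (intro ev) simp
      then have "\<forall>\<^sub>F i in sequentially. d i A \<le> \<nu> B + e"
        by eventually_elim (use d_mono[OF that] in \<open>auto intro: order_trans less_imp_le\<close>)
      then show "\<nu> A \<le> \<nu> B + e" by (rule \<nu>_le)
    qed
    show "\<nu> (A \<union> B) \<le> \<nu> A + \<nu> B" for A B
    proof (rule field_le_epsilon)
      fix e :: real assume e: "0 < e"
      have "\<forall>\<^sub>F i in sequentially. d i A < \<nu> A + e / 2" "\<forall>\<^sub>F i in sequentially. d i B < \<nu> B + e / 2"
        using e by (intro ev; simp)+
      then have "\<forall>\<^sub>F i in sequentially. d i (A \<union> B) \<le> \<nu> A + \<nu> B + e"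
      proof eventually_elim
        case (elim i)
        then show ?case using d_Un[of i A B] by simp
      qed
      then show "\<nu> (A \<union> B) \<le> \<nu> A + \<nu> B + e" by (rule \<nu>_le)
    qed
    show "\<nu> (g <#\<^bsub>G\<^esub> A) = \<nu> A" if "g \<in> carrier G" "A \<subseteq> carrier G" for g A
    proof (rule antisym)
      show "\<nu> (g <#\<^bsub>G\<^esub> A) \<le> \<nu> A" using d_inv[OF that] by (rule le)
      show "\<nu> A \<le> \<nu> (g <#\<^bsub>G\<^esub> A)"
        using tendsto_minus[OF d_inv[OF that]] by (intro le) simp
    qed
    show "real (card S) * \<nu> A \<le> 1"
      if S: "finite S" "S \<subseteq> carrier G" and A: "A \<subseteq> carrier G" and disj: "disjoint_family_on (\<lambda>g. g <#\<^bsub>G\<^esub> A) S"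
      for S A
    proof (cases "S = {}")
      case False
      then have n: "0 < card S" using S(1) by (simp add: card_gt_0_iff)
      have "\<nu> A \<le> 1 / real (card S)"
      proof (rule field_le_epsilon)
        fix e :: real assume e: "0 < e"
        have "\<forall>\<^sub>F i in sequentially. \<forall>g\<in>S. - e < d i (g <#\<^bsub>G\<^esub> A) - d i A"
          using S(1)
        proof (rule eventually_ball_finite, intro ballI)
          fix g assume "g \<in> S"
          with S(2) have "g \<in> carrier G" by blast
          from order_tendstoD(1)[OF d_inv[OF this A], of "- e"] e
          show "\<forall>\<^sub>F i in sequentially. - e < d i (g <#\<^bsub>G\<^esub> A) - d i A" by simp
        qed
        then have "\<forall>\<^sub>F i in sequentially. d i A \<le> 1 / real (card S) + e"
        proof eventually_elim
          case (elim i)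
          have "(\<Sum>g\<in>S. card (F i \<inter> (g <#\<^bsub>G\<^esub> A))) = card (\<Union>g\<in>S. F i \<inter> (g <#\<^bsub>G\<^esub> A))"
            using S(1) F(1) disj
            by (intro card_UN_disjoint[symmetric]) (auto simp: disjoint_family_on_def)
          also have "\<dots> \<le> card (F i)"
            using F(1) by (intro card_mono) auto
          finally have "real (\<Sum>g\<in>S. card (F i \<inter> (g <#\<^bsub>G\<^esub> A))) \<le> real (card (F i))"
            by (rule of_nat_mono)
          then have "(\<Sum>g\<in>S. d i (g <#\<^bsub>G\<^esub> A)) \<le> 1"
            unfolding d_def sum_divide_distrib[symmetric] using cF[of i] by (simp add: divide_le_eq)
          moreover have "(\<Sum>g\<in>S. d i A - e) \<le> (\<Sum>g\<in>S. d i (g <#\<^bsub>G\<^esub> A))"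
          proof (rule sum_mono)
            fix g assume "g \<in> S"
            with elim show "d i A - e \<le> d i (g <#\<^bsub>G\<^esub> A)" by force
          qed
          ultimately have "real (card S) * (d i A - e) \<le> 1" by simp
          then show ?case using n by (simp add: field_simps)
        qed
        then show "\<nu> A \<le> 1 / real (card S) + e" by (rule \<nu>_le)
      qed
      then show ?thesis using n by (simp add: field_simps)
    qed simp
  qed
qed

section \<open>Characterization of the Cantor set\<close>

text \<open>
  The point of the middle-thirds set whose ternary digits are \<open>2\<close> where \<open>b\<close> holds and \<open>0\<close> elsewhere.
\<close>

definition ternary :: "(nat \<Rightarrow> bool) \<Rightarrow> real"
  where "ternary b = (\<Sum>n. if b n then 2 / 3 ^ Suc n else 0)"

lemma ternary_summable: "summable (\<lambda>n. if b n then 2 / 3 ^ Suc n else 0 :: real)"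
proof (rule summable_comparison_test')
  show "summable (\<lambda>n. 2 / 3 * (1 / 3 :: real) ^ n)"
    by (intro summable_mult summable_geometric) simp
  show "norm (if b n then 2 / 3 ^ Suc n else 0 :: real) \<le> 2 / 3 * (1 / 3 :: real) ^ n" for n
    by (simp add: power_one_over)
qed

lemma ternary_unfold: "ternary b = ((if b 0 then 2 else 0) + ternary (\<lambda>n. b (Suc n))) / 3"
proof -
  have "(\<Sum>n. if b (Suc n) then 2 / 3 ^ Suc (Suc n) else 0 :: real) =
        (\<Sum>n. (if b (Suc n) then 2 / 3 ^ Suc n else 0) / 3)"
    by (intro suminf_cong) simp
  also have "\<dots> = ternary (\<lambda>n. b (Suc n)) / 3"
    unfolding ternary_def by (intro suminf_divide ternary_summable)
  finally show ?thesis
    using suminf_split_head[OF ternary_summable[of b]] by (auto simp: ternary_def field_simps)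
qed

lemma ternary_bounds: "0 \<le> ternary b" "ternary b \<le> 1"
proof -
  show "0 \<le> ternary b"
    unfolding ternary_def by (intro suminf_nonneg ternary_summable) simp
  have "ternary b \<le> (\<Sum>n. 2 / 3 * (1 / 3 :: real) ^ n)"
    unfolding ternary_def
    by (intro suminf_le ternary_summable summable_mult summable_geometric) (auto simp: power_one_over)
  also have "\<dots> = 1"
    by (subst suminf_mult) (auto simp: suminf_geometric intro!: summable_geometric)
  finally show "ternary b \<le> 1" .
qed

lemma ternary_in_cantor_set: "ternary b \<in> cantor_set"
proof -
  have "ternary b \<in> cantor_stage n" for n
  proof (induction n arbitrary: b)
    case 0
    then show ?case by (simp add: ternary_bounds)
  next
    case (Suc n)
    then show ?case by (subst ternary_unfold) (auto simp: add.commute)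
  qed
  then show ?thesis by (simp add: cantor_set_def)
qed

lemma ternary_inject: "ternary b = ternary b' \<longleftrightarrow> b = b'"
proof
  assume "ternary b = ternary b'"
  then have "b n = b' n" for n
  proof (induction n arbitrary: b b')
    case 0
    then show ?case
      using ternary_unfold[of b] ternary_unfold[of b'] ternary_bounds[of "\<lambda>n. b (Suc n)"]
        ternary_bounds[of "\<lambda>n. b' (Suc n)"]
      by (auto split: if_splits)
  next
    case (Suc n)
    then have "ternary (\<lambda>n. b (Suc n)) = ternary (\<lambda>n. b' (Suc n))"
      using ternary_unfold[of b] ternary_unfold[of b'] ternary_bounds[of "\<lambda>n. b (Suc n)"]
        ternary_bounds[of "\<lambda>n. b' (Suc n)"]
      by (auto split: if_splits)
    then show ?case by (rule Suc.IH)
  qed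
  then show "b = b'" by blast
qed simp

lemma ternary_agree: "(\<And>k. k < n \<Longrightarrow> b k = b' k) \<Longrightarrow> \<bar>ternary b - ternary b'\<bar> \<le> 1 / 3 ^ n"
proof (induction n arbitrary: b b')
  case 0
  then show ?case using ternary_bounds[of b] ternary_bounds[of b'] by simp
next
  case (Suc n)
  have "\<bar>ternary b - ternary b'\<bar> = \<bar>ternary (\<lambda>n. b (Suc n)) - ternary (\<lambda>n. b' (Suc n))\<bar> / 3"
    using Suc.prems[of 0] by (subst (1 2) ternary_unfold) (simp add: diff_divide_distrib[symmetric])
  also have "\<dots> \<le> (1 / 3 ^ n) / 3"
    using Suc.prems by (intro divide_right_mono Suc.IH) auto
  finally show ?case by (simp add: field_simps)
qed

lemma cantor_set_shift:
  assumes z: "z \<in> cantor_set"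
  shows "(if 1 / 2 < z then 3 * z - 2 else 3 * z) \<in> cantor_set"
proof -
  have stage01: "cantor_stage n \<subseteq> {0..1}" for n
    by (induction n) auto
  have "(if 1 / 2 < z then 3 * z - 2 else 3 * z) \<in> cantor_stage n" for n
  proof -
    have "z \<in> cantor_stage (Suc n)" using z unfolding cantor_set_def by blast
    then obtain y where y: "y \<in> cantor_stage n" "z = y / 3 \<or> z = (y + 2) / 3"
      by auto
    with stage01[of n] have "(if 1 / 2 < z then 3 * z - 2 else 3 * z) = y" by auto
    with y(1) show ?thesis by simp
  qed
  then show ?thesis by (simp add: cantor_set_def)
qed

text \<open>
  The digits of \<open>z\<close> are found by iterating the expanding map \<open>s\<close>, which is inverse to both
  contractions that build the set.
\<close>

lemma cantor_set_eq_range_ternary: "cantor_set = range ternary"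
proof
  show "range ternary \<subseteq> cantor_set" using ternary_in_cantor_set by blast
  define s :: "real \<Rightarrow> real" where "s z = (if 1 / 2 < z then 3 * z - 2 else 3 * z)" for z
  define e where "e z n \<longleftrightarrow> 1 / 2 < (s ^^ n) z" for z n
  have e_Suc: "(\<lambda>n. e z (Suc n)) = e (s z)" for z
    by (simp add: e_def fun_eq_iff funpow_swap1)
  have approx: "\<bar>ternary (e z) - z\<bar> \<le> 1 / 3 ^ n" if "z \<in> cantor_set" for n z
    using that
  proof (induction n arbitrary: z)
    case 0
    then have "z \<in> cantor_stage 0" unfolding cantor_set_def by blast
    then show ?case using ternary_bounds[of "e z"] by (simp add: abs_le_iff)
  next
    case (Suc n)
    have "s z \<in> cantor_set" unfolding s_def by (rule cantor_set_shift[OF Suc.prems])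
    then have "\<bar>ternary (e (s z)) - s z\<bar> \<le> 1 / 3 ^ n" by (rule Suc.IH)
    moreover have "ternary (e z) - z = (ternary (e (s z)) - s z) / 3"
      by (subst ternary_unfold, unfold e_Suc) (simp add: s_def e_def)
    ultimately have "\<bar>ternary (e z) - z\<bar> \<le> (1 / 3 ^ n) / 3" by simp
    then show ?case by (simp add: mult.commute)
  qed
  have "ternary (e z) = z" if "z \<in> cantor_set" for z
  proof (rule ccontr)
    assume "ternary (e z) \<noteq> z"
    then obtain n where "(1 / 3) ^ n < \<bar>ternary (e z) - z\<bar>"
      using real_arch_pow_inv[of "\<bar>ternary (e z) - z\<bar>" "1 / 3"] by auto
    with approx[OF that, of n] show False by (simp add: power_one_over)
  qed
  then show "cantor_set \<subseteq> range ternary" by (metis rangeI subsetI)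
qed

definition clopenin :: "'a::topological_space set \<Rightarrow> 'a set \<Rightarrow> bool"
  where "clopenin K C \<longleftrightarrow> openin (top_of_set K) C \<and> closedin (top_of_set K) C"

text \<open>
  Pairs of points at distance at least \<open>1 / (n + 1)\<close> form a compact set, so finitely many clopen
  sets separate all of them.
\<close>

lemma countable_separating_clopen:
  fixes K :: "'a::metric_space set"
  assumes K: "compact K"
    and sep: "\<And>x y. \<lbrakk>x \<in> K; y \<in> K; x \<noteq> y\<rbrakk> \<Longrightarrow> \<exists>C. clopenin K C \<and> x \<in> C \<and> y \<notin> C"
  obtains C :: "nat \<Rightarrow> 'a set" where "\<And>n. clopenin K (C n)"
    "\<And>x y. \<lbrakk>x \<in> K; y \<in> K; x \<noteq> y\<rbrakk> \<Longrightarrow> \<exists>n. x \<in> C n \<and> y \<notin> C n"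
proof -
  define Q where "Q = {(S, T). open S \<and> open T \<and> clopenin K (K \<inter> S) \<and> K \<inter> S \<inter> T = {}}"
  define D where "D n = (K \<times> K) \<inter> {p. 1 / real (Suc n) \<le> dist (fst p) (snd p)}" for n
  have "\<exists>F\<subseteq>Q. finite F \<and> D n \<subseteq> (\<Union>(S, T)\<in>F. S \<times> T)" for n
  proof -
    have "compact (D n)"
      unfolding D_def
      by (intro compact_Int_closed compact_Times K closed_Collect_le continuous_intros)
    moreover have "open (case q of (S, T) \<Rightarrow> S \<times> T)" if "q \<in> Q" for q
      using that by (auto simp: Q_def intro: open_Times)
    moreover have "D n \<subseteq> (\<Union>(S, T)\<in>Q. S \<times> T)"
    proof
      fix p assume p: "p \<in> D n"
      obtain x y where xy: "p = (x, y)" by (cases p)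
      with p have "x \<in> K" "y \<in> K" "x \<noteq> y" by (auto simp: D_def)
      with sep obtain C where C: "clopenin K C" "x \<in> C" "y \<notin> C" by blast
      then obtain S where S: "open S" "C = K \<inter> S"
        unfolding clopenin_def openin_open by blast
      have "openin (top_of_set K) (K - C)"
        using C(1) by (auto simp: clopenin_def closedin_def)
      then obtain T where T: "open T" "K - C = K \<inter> T"
        unfolding openin_open by blast
      have "(S, T) \<in> Q" "x \<in> S" "y \<in> T"
        using S T C \<open>y \<in> K\<close> by (auto simp: Q_def)
      then show "p \<in> (\<Union>(S, T)\<in>Q. S \<times> T)" using xy by blast
    qed
    ultimately obtain F where "F \<subseteq> Q" "finite F" "D n \<subseteq> (\<Union>q\<in>F. case q of (S, T) \<Rightarrow> S \<times> T)"
      by (rule compactE_image)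
    then show ?thesis by blast
  qed
  then obtain F where F: "\<And>n. F n \<subseteq> Q" "\<And>n. finite (F n)" "\<And>n. D n \<subseteq> (\<Union>(S, T)\<in>F n. S \<times> T)"
    by metis
  define \<C> where "\<C> = insert {} ((\<lambda>q. K \<inter> fst q) ` (\<Union>n. F n))"
  have "countable \<C>"
    unfolding \<C>_def using F(2) by (intro countable_insert countable_image countable_UN) (auto intro: countable_finite)
  then have rng: "range (from_nat_into \<C>) = \<C>"
    by (intro range_from_nat_into) (auto simp: \<C>_def)
  show thesis
  proof (rule that[of "from_nat_into \<C>"])
    have "clopenin K {}" by (simp add: clopenin_def)
    then have "clopenin K c" if "c \<in> \<C>" for c
      using that F(1) by (fastforce simp: \<C>_def Q_def)
    then show "clopenin K (from_nat_into \<C> n)" for n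
      using rng by blast
    show "\<exists>n. x \<in> from_nat_into \<C> n \<and> y \<notin> from_nat_into \<C> n" if xy: "x \<in> K" "y \<in> K" "x \<noteq> y" for x y
    proof -
      obtain n where "1 / real (Suc n) < dist x y"
        using nat_approx_posE[of "dist x y"] xy by auto
      with xy have "(x, y) \<in> D n" by (simp add: D_def)
      then obtain S T where ST: "(S, T) \<in> F n" "x \<in> S" "y \<in> T" using F(3) by blast
      have "K \<inter> S \<in> \<C>" using ST(1) unfolding \<C>_def by force
      moreover have "x \<in> K \<inter> S" "y \<notin> K \<inter> S"
        using ST xy F(1) by (auto simp: Q_def)
      ultimately show ?thesis using rng by (metis imageE)
    qed
  qed
qed

text \<open>
  Brouwer's characterization. Starting from \<open>K\<close>, every clopen piece is split into two non-empty
  clopen pieces, and in step \<open>n\<close> the split is made along the \<open>n\<close>-th set of a separating sequence whenever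
  that set cuts the piece. Each point gets the sequence of its left-right choices as an address,
  and the address is read as ternary digits. Distinct points have distinct addresses because the
  sequence separates them.
\<close>

theorem homeomorphic_cantor_set:
  fixes K :: "'a::metric_space set"
  assumes K: "compact K" "K \<noteq> {}" and perfect: "\<And>x. x \<in> K \<Longrightarrow> x islimpt K"
    and sep: "\<And>x y. \<lbrakk>x \<in> K; y \<in> K; x \<noteq> y\<rbrakk> \<Longrightarrow> \<exists>C. clopenin K C \<and> x \<in> C \<and> y \<notin> C"
  shows "K homeomorphic cantor_set"
proof -
  obtain C where C: "\<And>n::nat. clopenin K (C n)"
    "\<And>x y. \<lbrakk>x \<in> K; y \<in> K; x \<noteq> y\<rbrakk> \<Longrightarrow> \<exists>n. x \<in> C n \<and> y \<notin> C n"
    using countable_separating_clopen[OF K(1) sep] by blast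
  have Int: "clopenin K (S \<inter> T)" and Diff: "clopenin K (S - T)"
    if "clopenin K S" "clopenin K T" for S T
    using that by (auto simp: clopenin_def openin_Int closedin_Int openin_diff closedin_diff)
  have split: "\<exists>S0. clopenin K S \<and> S \<noteq> {} \<longrightarrow>
      S0 \<subseteq> S \<and> clopenin K S0 \<and> S0 \<noteq> {} \<and> S - S0 \<noteq> {} \<and>
      (S0 \<subseteq> C n \<or> S0 \<inter> C n = {}) \<and> (S - S0 \<subseteq> C n \<or> (S - S0) \<inter> C n = {})" for S n
  proof (cases "clopenin K S \<and> S \<noteq> {}")
    case True
    \<comment> \<open>If \<open>C n\<close> does not cut \<open>S\<close>, any split will do; \<open>S\<close> has two points since \<open>K\<close> is perfect.\<close>
    show ?thesis
    proof (cases "S \<inter> C n \<noteq> {} \<and> S - C n \<noteq> {}")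
      case True
      then show ?thesis
        using Int[of S "C n"] C(1)[of n] by (intro exI[of _ "S \<inter> C n"]) auto
    next
      case False
      obtain x where x: "x \<in> S" using True by blast
      have SK: "S \<subseteq> K" using True openin_imp_subset unfolding clopenin_def by blast
      obtain T where T: "open T" "S = K \<inter> T"
        using True unfolding clopenin_def openin_open by blast
      with x SK obtain y where y: "y \<in> K" "y \<in> T" "y \<noteq> x"
        using perfect[of x] unfolding islimpt_def by blast
      then obtain B where B: "clopenin K B" "x \<in> B" "y \<notin> B"
        using sep[of x y] x SK by blast
      then show ?thesis
        using Int[of S B] True False x y T by (intro exI[of _ "S \<inter> B"]) blast
    qed
  qed blast
  define sp where "sp n S = (SOME S0. clopenin K S \<and> S \<noteq> {} \<longrightarrow>
      S0 \<subseteq> S \<and> clopenin K S0 \<and> S0 \<noteq> {} \<and> S - S0 \<noteq> {} \<and>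
      (S0 \<subseteq> C n \<or> S0 \<inter> C n = {}) \<and> (S - S0 \<subseteq> C n \<or> (S - S0) \<inter> C n = {}))" for n S
  have sp: "clopenin K S \<and> S \<noteq> {} \<longrightarrow>
      sp n S \<subseteq> S \<and> clopenin K (sp n S) \<and> sp n S \<noteq> {} \<and> S - sp n S \<noteq> {} \<and>
      (sp n S \<subseteq> C n \<or> sp n S \<inter> C n = {}) \<and> (S - sp n S \<subseteq> C n \<or> (S - sp n S) \<inter> C n = {})" for n S
    unfolding sp_def by (rule someI_ex[OF split])
  define node where "node b = rec_nat K (\<lambda>n S. if b n then sp n S else S - sp n S)" for b :: "nat \<Rightarrow> bool"
  have node_0: "node b 0 = K" and node_Suc: "node b (Suc n) =
      (if b n then sp n (node b n) else node b n - sp n (node b n))" for b n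
    by (simp_all add: node_def)
  have node: "clopenin K (node b n) \<and> node b n \<noteq> {}" for b n
  proof (induction n)
    case 0
    then show ?case using K(2) by (simp add: node_0 clopenin_def)
  next
    case (Suc n)
    then show ?case using sp[of "node b n" n] Diff by (auto simp: node_Suc)
  qed
  have node_sub: "node b (Suc n) \<subseteq> node b n" for b n
    using sp[of "node b n" n] node[of b n] by (auto simp: node_Suc)
  have node_anti: "node b n \<subseteq> node b m" if "m \<le> n" for b m n
    using node_sub that by (rule lift_Suc_antimono_le)
  have node_side: "node b (Suc n) \<subseteq> C n \<or> node b (Suc n) \<inter> C n = {}" for b n
    using sp[of "node b n" n] node[of b n] by (auto simp: node_Suc)
  have node_agree: "b k = b' k" if "x \<in> node b n" "x \<in> node b' n" "k < n" for x b b' k n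
    using that(3)
  proof (induction k rule: less_induct)
    case (less k)
    have "node b j = node b' j" if "j \<le> k" for j
      using that
    proof (induction j)
      case (Suc j)
      then show ?case using less.IH[of j] less.prems by (simp add: node_Suc)
    qed (simp add: node_0)
    then have "node b k = node b' k" by simp
    moreover have "x \<in> node b (Suc k)" "x \<in> node b' (Suc k)"
      using that(1,2) node_anti[of "Suc k" n] less.prems by auto
    ultimately show ?case by (auto simp: node_Suc split: if_splits)
  qed
  have ex: "\<exists>b. \<forall>n. x \<in> node b n" if x: "x \<in> K" for x
  proof -
    define piece where "piece = rec_nat K (\<lambda>n S. if x \<in> sp n S then sp n S else S - sp n S)"
    define b where "b n \<longleftrightarrow> x \<in> sp n (piece n)" for n
    have "node b n = piece n \<and> x \<in> piece n" for n
      by (induction n) (auto simp: node_0 node_Suc piece_def b_def x)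
    then show ?thesis by metis
  qed
  then obtain a where a: "\<And>x n. x \<in> K \<Longrightarrow> x \<in> node (a x) n" by metis
  have inj: "inj_on (\<lambda>x. ternary (a x)) K"
  proof (rule inj_onI, rule ccontr)
    fix x y assume xy: "x \<in> K" "y \<in> K" "ternary (a x) = ternary (a y)" "x \<noteq> y"
    then obtain n where "x \<in> C n" "y \<notin> C n" using C(2) by blast
    moreover have "x \<in> node (a x) (Suc n)" "y \<in> node (a x) (Suc n)"
      using a[OF xy(1), of "Suc n"] a[OF xy(2), of "Suc n"] xy(3) by (auto simp: ternary_inject)
    ultimately show False using node_side[of "a x" n] by blast
  qed
  have cont: "continuous_on K (\<lambda>x. ternary (a x))"
    unfolding continuous_on_iff
  proof (intro ballI allI impI)
    fix x and e :: real assume x: "x \<in> K" and e: "0 < e"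
    obtain n where n: "(1 / 3) ^ n < e"
      using real_arch_pow_inv[OF e, of "1 / 3"] by auto
    have "openin (top_of_set K) (node (a x) n)" using node by (simp add: clopenin_def)
    with a[OF x, of n] obtain d where d: "0 < d" "\<And>y. y \<in> K \<Longrightarrow> dist y x < d \<Longrightarrow> y \<in> node (a x) n"
      unfolding openin_euclidean_subtopology_iff by blast
    show "\<exists>d>0. \<forall>y\<in>K. dist y x < d \<longrightarrow> dist (ternary (a y)) (ternary (a x)) < e"
    proof (intro exI[of _ d] conjI ballI impI)
      fix y assume y: "y \<in> K" "dist y x < d"
      have "\<bar>ternary (a y) - ternary (a x)\<bar> \<le> 1 / 3 ^ n"
        by (intro ternary_agree node_agree[OF a[OF y(1)] d(2)[OF y]])
      with n show "dist (ternary (a y)) (ternary (a x)) < e"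
        by (simp add: dist_real_def power_one_over)
    qed (fact d)
  qed
  have "(\<lambda>x. ternary (a x)) ` K = range ternary"
  proof
    show "range ternary \<subseteq> (\<lambda>x. ternary (a x)) ` K"
    proof clarify
      fix b
      have "K \<inter> (\<Inter>n\<in>UNIV. node b n) \<noteq> {}"
      proof (rule compact_imp_fip_image[OF K(1)])
        show "closed (node b n)" for n
          using node[of b n] compact_imp_closed[OF K(1)] closedin_closed_trans
          by (auto simp: clopenin_def)
        fix J :: "nat set" assume "finite J"
        then obtain l where l: "\<And>k. k \<in> J \<Longrightarrow> k \<le> l"
          using finite_nat_set_iff_bounded_le by meson
        have "node b l \<subseteq> K \<inter> (\<Inter>n\<in>J. node b n)"
          using node_anti l node_anti[of 0 l b] by (auto simp: node_0)
        then show "K \<inter> (\<Inter>n\<in>J. node b n) \<noteq> {}" using node[of b l] by blast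
      qed
      then obtain x where x: "x \<in> K" "\<And>n. x \<in> node b n" by blast
      have "a x = b"
        using node_agree[OF a[OF x(1)] x(2)] by (intro ext) (metis lessI)
      with x(1) show "ternary b \<in> (\<lambda>x. ternary (a x)) ` K" by blast
    qed
  qed auto
  then show ?thesis
    unfolding cantor_set_eq_range_ternary using K(1) cont inj by (intro homeomorphic_compact)
qed

section \<open>Minimal sets of actions on dendrites\<close>

locale minimal_dendrite_action = dendrite_space X + group G
  for X :: "'a::metric_space set" and G :: "('g, 'm) monoid_scheme" (structure) +
  fixes \<phi> :: "'g \<Rightarrow> 'a \<Rightarrow> 'a" and K :: "'a set"
  assumes action: "homeo_action G X \<phi>" and minimal: "minimal_set G X \<phi> K"
begin

lemma \<phi>_carrier: "g \<in> carrier G \<Longrightarrow> \<phi> g \<in> extensional X \<and> (\<exists>f'. homeomorphism X X (\<phi> g) f')"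
  using action by (auto simp: homeo_action_def hom_def Homeo_def)

lemma \<phi>_closed: "g \<in> carrier G \<Longrightarrow> x \<in> X \<Longrightarrow> \<phi> g x \<in> X"
  using \<phi>_carrier[of g] by (auto simp: homeomorphism_def)

lemma \<phi>_mult: "\<phi> (g \<otimes> h) x = \<phi> g (\<phi> h x)"
  if "g \<in> carrier G" "h \<in> carrier G" "x \<in> X"
proof -
  have bij: "\<phi> g \<in> Bij X" if "g \<in> carrier G" for g
    using \<phi>_carrier[OF that] subgroup.subset[OF subgroup_Homeo, of X]
    by (auto simp: Homeo_def BijGroup_def)
  show ?thesis
    using action that bij
    by (auto simp: homeo_action_def hom_def Homeo_def BijGroup_def compose_def)
qed

lemma \<phi>_one: "\<phi> \<one> x = x" if "x \<in> X"
proof -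
  obtain f' where f': "homeomorphism X X (\<phi> \<one>) f'" using \<phi>_carrier[OF one_closed] by blast
  have "\<phi> \<one> (\<phi> \<one> x) = \<phi> \<one> x" using \<phi>_mult[of \<one> \<one> x] that by simp
  then show ?thesis
    using f' that \<phi>_closed[OF one_closed that] unfolding homeomorphism_def by metis
qed

lemma \<phi>_inv [simp]:
  assumes "g \<in> carrier G" "x \<in> X"
  shows "\<phi> (inv g) (\<phi> g x) = x" "\<phi> g (\<phi> (inv g) x) = x"
  using \<phi>_mult[of "inv g" g x] \<phi>_mult[of g "inv g" x] \<phi>_one assms by auto

lemma \<phi>_homeomorphism: "homeomorphism X X (\<phi> g) (\<phi> (inv g))" if g: "g \<in> carrier G"
proof (rule homeomorphismI)
  show "continuous_on X (\<phi> g)" "continuous_on X (\<phi> (inv g))"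
    using \<phi>_carrier[OF g] \<phi>_carrier[OF inv_closed[OF g]] by (auto simp: homeomorphism_def)
qed (use g \<phi>_closed in auto)

lemma K_subset: "K \<subseteq> X" and K_nonempty: "K \<noteq> {}" and compact_K: "compact K"
proof -
  have "closedin (top_of_set X) K" "K \<noteq> {}" using minimal by (auto simp: minimal_set_def)
  then show "K \<subseteq> X" "K \<noteq> {}" "compact K"
    using compact_X closedin_compact closedin_imp_subset by (blast, blast, blast)
qed

lemma \<phi>_K: "\<phi> g x \<in> K" if "g \<in> carrier G" "x \<in> K"
  using minimal that by (auto simp: minimal_set_def invariant_set_def orbit_def)

lemma orbit_meets_open:
  assumes "x \<in> K" "openin (top_of_set X) U" "U \<inter> K \<noteq> {}"
  obtains g where "g \<in> carrier G" "\<phi> g x \<in> U"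
proof -
  obtain y where "y \<in> U" "y \<in> K" using assms(3) by blast
  then have "y \<in> (top_of_set X) closure_of (orbit G \<phi> x)"
    using minimal assms(1) by (auto simp: minimal_set_def)
  then obtain z where "z \<in> orbit G \<phi> x" "z \<in> U"
    using assms(2) \<open>y \<in> U\<close> unfolding in_closure_of by blast
  then show thesis using that by (auto simp: orbit_def)
qed

lemma branch_image: "\<phi> g ` H \<in> branches" if g: "g \<in> carrier G" and "H \<in> branches"
proof -
  obtain c x where H: "c \<in> X" "x \<in> X - {c}" "H = branch c x"
    using \<open>H \<in> branches\<close> unfolding branches_iff by blast
  have "\<phi> g x \<noteq> \<phi> g c" using H \<phi>_inv(1)[OF g] by (metis DiffD1 DiffD2 singletonI)
  then show ?thesis
    unfolding H(3) homeomorphism_image_branch[OF \<phi>_homeomorphism[OF g] H(1,2)]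
    using H \<phi>_closed[OF g] by (intro branch_in_branches) auto
qed

lemma openin_image: "openin (top_of_set X) (\<phi> g ` U)"
  if "g \<in> carrier G" "openin (top_of_set X) U"
  using homeomorphism_imp_open_map[OF \<phi>_homeomorphism[OF that(1)] that(2)] .

text \<open>
  By minimality every orbit in \<open>K\<close> visits an isolated point, so one isolated point makes all
  points of \<open>K\<close> isolated.
\<close>

lemma isolated_imp_finite:
  assumes x: "x \<in> K" "\<not> x islimpt K"
  shows "finite K"
proof (rule ccontr)
  assume "infinite K"
  then obtain y where y: "y \<in> K" "y islimpt K"
    using compact_K unfolding compact_eq_Bolzano_Weierstrass by blast
  obtain T where T: "x \<in> T" "open T" "\<And>z. z \<in> K \<Longrightarrow> z \<in> T \<Longrightarrow> z = x"
    using x(2) unfolding islimpt_def by blast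
  obtain g where g: "g \<in> carrier G" "\<phi> g y \<in> X \<inter> T"
    using orbit_meets_open[OF y(1), of "X \<inter> T"] T x K_subset by blast
  have "continuous_on X (\<phi> g)" using \<phi>_homeomorphism[OF g(1)] by (simp add: homeomorphism_def)
  then obtain T' where T': "open T'" "T' \<inter> X = \<phi> g -` T \<inter> X"
    using T(2) unfolding continuous_on_open_invariant by blast
  have "y \<in> T'" using T'(2) g(2) y(1) K_subset by blast
  then obtain z where z: "z \<in> K" "z \<in> T'" "z \<noteq> y"
    using y(2) T'(1) unfolding islimpt_def by blast
  then have "\<phi> g z = x" "\<phi> g y = x"
    using T' g T(3) \<phi>_K[OF g(1)] y(1) K_subset by blast+
  then show False
    using z y(1) \<phi>_inv(1)[OF g(1)] K_subset by (metis subsetD)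
qed

lemma infinite_orbit:
  assumes "infinite K" "x \<in> K"
  shows "infinite ((\<lambda>g. \<phi> g x) ` carrier G)"
proof
  let ?O = "(\<lambda>g. \<phi> g x) ` carrier G"
  assume fin: "finite ?O"
  then have "openin (top_of_set X) (X - ?O)"
    by (intro openin_diff openin_subtopology_self finite_imp_closedin)
      (use assms K_subset \<phi>_K in auto)
  moreover have "(X - ?O) \<inter> K \<noteq> {}"
  proof
    assume "(X - ?O) \<inter> K = {}"
    then have "K \<subseteq> ?O" using K_subset by blast
    then show False using assms(1) fin finite_subset by auto
  qed
  ultimately show False
    using orbit_meets_open[OF assms(2)] by blast
qed

text \<open>
  Fix a root \<open>c \<in> K\<close> and let \<open>e\<close> be a maximal element of \<open>K - {c}\<close> with respect to ``lies beyond, seen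
  from \<open>c\<close>''. The branches of \<open>e\<close> at the points \<open>\<gamma> t\<close> of the arc from \<open>c\<close> to \<open>e\<close> decrease with
  \<open>t\<close>. Any other \<open>y \<in> K\<close> is not beyond \<open>e\<close>, so a path joins \<open>y\<close> to \<open>c\<close> without meeting \<open>e\<close>; when \<open>\<gamma> t\<close> is
  closer to \<open>e\<close> than this path, \<open>\<gamma> t\<close> separates \<open>y\<close> from \<open>e\<close>. Compactness of \<open>K\<close> outside a ball
  makes one \<open>t\<close> work for all \<open>y\<close> at once.
\<close>

lemma exists_branch_neighbourhoods:
  assumes "infinite K"
  obtains e where "e \<in> K" "\<And>r. 0 < r \<Longrightarrow> \<exists>H\<in>branches. e \<in> H \<and> H \<inter> K \<subseteq> ball e r"
proof -
  obtain c where c: "c \<in> K" using K_nonempty by blast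
  define A where "A = K - {c}"
  have "A \<noteq> {}" using assms unfolding A_def by (metis finite.emptyI finite_insert insert_Diff_single finite_Diff2)
  have cX: "c \<in> X - {x}" if "x \<in> A" for x using that c K_subset by (auto simp: A_def)
  have AX: "x \<in> X" if "x \<in> A" for x using that K_subset by (auto simp: A_def)
  define P where "P x y \<longleftrightarrow> y \<notin> branch x c" for x y
  have P_refl: "P x x" for x using branch_subset by (auto simp: P_def)
  have P_nest: "insert x (branch x c) \<subseteq> branch y c" if "x \<in> A" "P x y" "y \<noteq> x" for x y
    using that cX AX by (intro branch_nested) (auto simp: P_def)
  have P_trans: "P a d" if "a \<in> A" "P a b" "P b d" for a b d
    using P_nest[OF that(1,2)] that(2,3) unfolding P_def by blast
  have po: "partial_order_on A (relation_of P A)"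
  proof (rule partial_order_on_relation_ofI)
    show "P a a" for a by (rule P_refl)
    show "P a d" if "a \<in> A" "P a b" "P b d" for a b d
      using that by (rule P_trans)
    show "a = b" if "a \<in> A" "P a b" "P b a" for a b
      using P_nest[OF that(1,2)] that(3) unfolding P_def by blast
  qed
  have "\<exists>u\<in>A. \<forall>a\<in>C. P a u" if C: "C \<in> Chains (relation_of P A)" for C
  proof (cases "C = {}")
    case False
    have CA: "C \<subseteq> A" using C by (auto simp: Chains_def relation_of_def)
    have top: "\<exists>m\<in>J. \<forall>x\<in>J. P x m" if "finite J" "J \<noteq> {}" "J \<subseteq> C" for J
      using that
    proof (induction J rule: finite_ne_induct)
      case (singleton x)
      then show ?case using P_refl by blast
    next
      case (insert x J)
      then obtain m where m: "m \<in> J" "\<forall>y\<in>J. P y m" by blast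
      have "P x m \<or> P m x" using C insert.prems m(1) by (auto simp: Chains_def relation_of_def)
      then show ?case
      proof
        assume "P m x"
        then have "P y x" if "y \<in> J" for y
          using P_trans[of y m x] m(2) that insert.prems CA by blast
        then show ?thesis using P_refl by blast
      qed (use m in blast)
    qed
    have "K \<inter> (\<Inter>x\<in>C. X - branch x c) \<noteq> {}"
    proof (rule compact_imp_fip_image[OF compact_K])
      show "closed (X - branch x c)" for x
      proof -
        have "closedin (top_of_set X) (X - branch x c)"
          by (intro closedin_diff closedin_subtopology_refl[THEN iffD2] openin_branch) simp
        then show ?thesis
          using compact_imp_closed[OF compact_X] by (rule closedin_closed_trans)
      qed
      show "K \<inter> (\<Inter>x\<in>J. X - branch x c) \<noteq> {}" if J: "finite J" "J \<subseteq> C" for J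
      proof (cases "J = {}")
        case False
        then obtain m where m: "m \<in> J" "\<forall>x\<in>J. P x m"
          using top[OF J(1) _ J(2)] by blast
        then have "m \<in> A" using J CA by auto
        then have "m \<in> K" "m \<in> X" using AX by (auto simp: A_def)
        moreover have "\<forall>x\<in>J. m \<notin> branch x c" using m(2) unfolding P_def .
        ultimately have "m \<in> K \<inter> (\<Inter>x\<in>J. X - branch x c)" by simp
        then show ?thesis by blast
      qed (use K_nonempty in simp)
    qed
    then have "\<exists>u. \<forall>x\<in>C. u \<in> K - branch x c" by blast
    then obtain u where u: "\<And>x. x \<in> C \<Longrightarrow> u \<in> K - branch x c" by blast
    obtain x where x: "x \<in> C" using False by blast
    have "u \<noteq> c" using u[OF x] branch_self[OF cX] CA x by blast
    then have "u \<in> A" using u[OF x] by (auto simp: A_def)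
    with u show ?thesis by (auto simp: P_def)
  qed (use \<open>A \<noteq> {}\<close> in auto)
  then obtain e where e: "e \<in> A" and emax: "\<And>a. a \<in> A \<Longrightarrow> P e a \<Longrightarrow> a = e"
    using predicate_Zorn[OF po] by blast
  have eX: "e \<in> X" "e \<in> K" "e \<noteq> c" using e K_subset by (auto simp: A_def)
  have cX': "c \<in> X" using c K_subset by blast
  obtain \<gamma> where \<gamma>: "arc \<gamma>" "path_image \<gamma> \<subseteq> X" "pathstart \<gamma> = c" "pathfinish \<gamma> = e"
    and sep: "\<And>t. t \<in> {0<..<1} \<Longrightarrow> \<gamma> t \<in> X - {c, e} \<and> e \<notin> branch (\<gamma> t) c"
    using separating_arc[OF cX' eX(1)] eX(3) by metis
  have \<gamma>01: "\<gamma> 0 = c" "\<gamma> 1 = e" using \<gamma> by (auto simp: pathstart_def pathfinish_def)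
  have cont: "continuous_on {0..1} \<gamma>" using \<gamma>(1) by (auto simp: arc_def path_def)
  have inj: "inj_on \<gamma> {0..1}" using \<gamma>(1) by (simp add: arc_def)
  define H where "H t = branch (\<gamma> t) e" for t
  have disj: "branch (\<gamma> t) c \<inter> H t = {}" if "t \<in> {0<..<1}" for t
    using sep[OF that] connected_component_disjoint[of "X - {\<gamma> t}" e c] unfolding H_def by blast
  have part: "\<gamma> u \<in> branch (\<gamma> t) (\<gamma> d)"
    if "0 \<le> a" "b \<le> 1" "t \<in> {0..1}" "t \<notin> {a..b}" "d \<in> {a..b}" "u \<in> {a..b}" for a b t d u
  proof -
    have "\<gamma> ` {a..b} \<subseteq> branch (\<gamma> t) (\<gamma> d)"
    proof (rule connected_component_maximal)
      show "connected (\<gamma> ` {a..b})"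
        using that by (intro connected_continuous_image continuous_on_subset[OF cont]) auto
      show "\<gamma> ` {a..b} \<subseteq> X - {\<gamma> t}"
      proof (rule image_subsetI)
        fix u assume u: "u \<in> {a..b}"
        then have "u \<in> {0..1}" "u \<noteq> t" using that by auto
        then show "\<gamma> u \<in> X - {\<gamma> t}"
          using \<gamma>(2) inj_on_eq_iff[OF inj, of u t] that(3) by (auto simp: path_image_def)
      qed
    qed (use that in simp)
    then show ?thesis using that(6) by blast
  qed
  have H_nest: "insert (\<gamma> t) (H t) \<subseteq> H s" if st: "0 < s" "s < t" "t < 1" for s t
    unfolding H_def
  proof (rule branch_absorbs_branch)
    have "\<gamma> t \<in> branch (\<gamma> s) (\<gamma> 1)"
      by (rule part[of t 1]) (use st in auto)
    then show "\<gamma> t \<in> branch (\<gamma> s) e" unfolding \<gamma>01 .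
    show "e \<in> X - {\<gamma> t}" using sep[of t] st eX(1) by auto
    have "\<gamma> s \<in> branch (\<gamma> t) (\<gamma> 0)"
      by (rule part[of 0 s]) (use st in auto)
    then have "\<gamma> s \<in> branch (\<gamma> t) c" unfolding \<gamma>01 .
    moreover have "branch (\<gamma> t) c \<inter> H t = {}" using st by (intro disj) simp
    ultimately show "\<gamma> s \<notin> branch (\<gamma> t) e" unfolding H_def by blast
  qed
  have away: "\<exists>t\<in>{0<..<1}. y \<notin> insert (\<gamma> t) (H t)" if y: "y \<in> K - {e}" for y
  proof (cases "y = c")
    case True
    have half: "1/2 \<in> {0<..<1::real}" by simp
    then have "c \<in> branch (\<gamma> (1/2)) c" using sep[OF half] cX' by (intro branch_self) blast
    then have "c \<notin> insert (\<gamma> (1/2)) (H (1/2))"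
      using sep[OF half] disj[OF half] by blast
    with half True show ?thesis by blast
  next
    case False
    with y emax[of y] have yc: "y \<in> branch e c" by (auto simp: A_def P_def)
    have "path_connected (branch e c)"
      using compact_X locally_connected_X openin_branch connected_connected_component
      by (rule open_connected_imp_path_connected)
    moreover have "c \<in> branch e c" using cX[OF e] by simp
    ultimately obtain p where p: "path p" "path_image p \<subseteq> branch e c" "pathstart p = c" "pathfinish p = y"
      using yc unfolding path_connected_def by blast
    have "e \<in> - path_image p" using p(2) branch_subset by blast
    moreover have "open (- path_image p)"
      using compact_path_image[OF p(1)] compact_imp_closed by blast
    ultimately obtain r where r: "0 < r" "ball e r \<subseteq> - path_image p"
      unfolding open_contains_ball by blast
    obtain d where d: "0 < d" "\<And>t. t \<in> {0..1} \<Longrightarrow> dist t 1 < d \<Longrightarrow> dist (\<gamma> t) (\<gamma> 1) < r"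
      using cont r(1) unfolding continuous_on_iff by (metis atLeastAtMost_iff order_refl zero_le_one)
    define t where "t = max (1/2) (1 - d/2)"
    have t: "t \<in> {0<..<1}" "dist t 1 < d" using d(1) by (auto simp: t_def dist_real_def)
    then have "\<gamma> t \<in> ball e r" using d(2)[of t] \<gamma>01 by (auto simp: dist_commute)
    then have "\<gamma> t \<notin> path_image p" using r(2) by blast
    then have "path_image p \<subseteq> X - {\<gamma> t}"
      using p(2) branch_subset by blast
    then have "path_image p \<subseteq> branch (\<gamma> t) c"
      using p connected_path_image[OF p(1)] pathstart_in_path_image[of p]
      by (intro connected_component_maximal) auto
    then have "y \<in> branch (\<gamma> t) c" using p(4) pathfinish_in_path_image by blast
    then have "y \<notin> insert (\<gamma> t) (H t)"
      using disj[OF t(1)] branch_subset[of "\<gamma> t" c] by blast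
    with t(1) show ?thesis by blast
  qed
  have basis: "\<exists>B\<in>branches. e \<in> B \<and> B \<inter> K \<subseteq> ball e r" if r: "0 < r" for r
  proof -
    have "compact (K - ball e r)" using compact_K by (simp add: compact_diff)
    moreover have "open (- insert (\<gamma> t) (H t))" if "t \<in> {0<..<1}" for t
      using closed_insert_branch[of "\<gamma> t" e] sep[OF that] by (auto simp: H_def)
    moreover have "K - ball e r \<subseteq> (\<Union>t\<in>{0<..<1}. - insert (\<gamma> t) (H t))"
      using away r by fastforce
    ultimately obtain J where J: "J \<subseteq> {0<..<1}" "finite J"
      "K - ball e r \<subseteq> (\<Union>t\<in>J. - insert (\<gamma> t) (H t))"
      by (rule compactE_image)
    define t where "t = Max (insert (1/2) J)"
    have "t \<in> insert (1/2) J" unfolding t_def using J(2) by (intro Max_in) auto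
    then have t: "t \<in> {0<..<1}" using J(1) by auto
    have "H t \<subseteq> insert (\<gamma> s) (H s)" if "s \<in> J" for s
    proof -
      have "s \<le> t" unfolding t_def using J(2) that by simp
      moreover have "0 < s" using J(1) that by auto
      ultimately show ?thesis using H_nest[of s t] t by (cases "s = t") auto
    qed
    then have "H t \<subseteq> (\<Inter>s\<in>J. insert (\<gamma> s) (H s))" by (rule INT_greatest)
    also have "\<dots> = - (\<Union>s\<in>J. - insert (\<gamma> s) (H s))" by simp
    also have "\<dots> \<subseteq> - (K - ball e r)" using J(3) by (rule Compl_anti_mono)
    finally have "H t \<inter> K \<subseteq> ball e r" by blast
    moreover have "e \<in> X - {\<gamma> t}" "\<gamma> t \<in> X" using sep[OF t] eX(1) by auto
    then have "e \<in> H t" "H t \<in> branches"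
      unfolding H_def by (simp, intro branch_in_branches)
    ultimately show ?thesis by blast
  qed
  show thesis by (rule that[of e, OF eX(2) basis])
qed

text \<open>
  The mass of \<open>A\<close> is the size of the set of group elements that move a base point into \<open>A\<close>.
\<close>

lemma exists_invariant_mass:
  assumes "amenable G"
  obtains mass :: "'a set \<Rightarrow> real" where
    "mass K = 1" "\<And>A. mass (A \<inter> K) = mass A"
    "\<And>A B. A \<subseteq> B \<Longrightarrow> mass A \<le> mass B"
    "\<And>A B. mass (A \<union> B) \<le> mass A + mass B"
    "\<And>g A. \<lbrakk>g \<in> carrier G; A \<subseteq> X\<rbrakk> \<Longrightarrow> mass (\<phi> g ` A) = mass A"
    "\<And>S A. \<lbrakk>finite S; S \<subseteq> carrier G; A \<subseteq> X; disjoint_family_on (\<lambda>g. \<phi> g ` A) S\<rbrakk>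
        \<Longrightarrow> real (card S) * mass A \<le> 1"
proof -
  obtain \<nu> :: "'g set \<Rightarrow> real" where \<nu>: "\<nu> (carrier G) = 1"
    "\<And>A B. A \<subseteq> B \<Longrightarrow> \<nu> A \<le> \<nu> B"
    "\<And>A B. \<nu> (A \<union> B) \<le> \<nu> A + \<nu> B"
    "\<And>g A. \<lbrakk>g \<in> carrier G; A \<subseteq> carrier G\<rbrakk> \<Longrightarrow> \<nu> (g <#\<^bsub>G\<^esub> A) = \<nu> A"
    "\<And>S A. \<lbrakk>finite S; S \<subseteq> carrier G; A \<subseteq> carrier G; disjoint_family_on (\<lambda>g. g <#\<^bsub>G\<^esub> A) S\<rbrakk>
        \<Longrightarrow> real (card S) * \<nu> A \<le> 1"
    using amenable_imp_invariant_submeasure[OF is_group assms] by metis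
  obtain x where x: "x \<in> K" using K_nonempty by blast
  define V where "V A = {h \<in> carrier G. \<phi> h x \<in> A}" for A
  have hx: "\<phi> h x \<in> K" "\<phi> h x \<in> X" if "h \<in> carrier G" for h
    using \<phi>_K[OF that x] K_subset by auto
  have xX: "x \<in> X" using x K_subset by blast
  have V_image: "V (\<phi> g ` A) = g <#\<^bsub>G\<^esub> V A" if g: "g \<in> carrier G" and A: "A \<subseteq> X" for g A
  proof
    show "V (\<phi> g ` A) \<subseteq> g <#\<^bsub>G\<^esub> V A"
    proof
      fix h assume "h \<in> V (\<phi> g ` A)"
      then obtain a where h: "h \<in> carrier G" "a \<in> A" "\<phi> h x = \<phi> g a" by (auto simp: V_def)
      have "\<phi> (inv g \<otimes> h) x = a"
        using \<phi>_mult[of "inv g" h x] g h xX A by auto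
      then have "inv g \<otimes> h \<in> V A" using h g by (simp add: V_def)
      moreover have "h = g \<otimes> (inv g \<otimes> h)" using g h by (simp add: m_assoc[symmetric])
      ultimately show "h \<in> g <#\<^bsub>G\<^esub> V A" unfolding l_coset_def by blast
    qed
    show "g <#\<^bsub>G\<^esub> V A \<subseteq> V (\<phi> g ` A)"
      using g xX by (auto simp: V_def l_coset_def \<phi>_mult)
  qed
  show thesis
  proof (rule that[of "\<lambda>A. \<nu> (V A)"])
    have "V K = carrier G" using hx by (auto simp: V_def)
    then show "\<nu> (V K) = 1" using \<nu>(1) by simp
    show "\<nu> (V (A \<inter> K)) = \<nu> (V A)" for A
    proof -
      have "V (A \<inter> K) = V A" using hx by (auto simp: V_def)
      then show ?thesis by simp
    qed
    show "\<nu> (V A) \<le> \<nu> (V B)" if "A \<subseteq> B" for A B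
      using that by (intro \<nu>(2)) (auto simp: V_def)
    show "\<nu> (V (A \<union> B)) \<le> \<nu> (V A) + \<nu> (V B)" for A B
    proof -
      have "V (A \<union> B) = V A \<union> V B" by (auto simp: V_def)
      then show ?thesis using \<nu>(3) by simp
    qed
    show "\<nu> (V (\<phi> g ` A)) = \<nu> (V A)" if "g \<in> carrier G" "A \<subseteq> X" for g A
      unfolding V_image[OF that] using that(1) by (intro \<nu>(4)) (auto simp: V_def)
    show "real (card S) * \<nu> (V A) \<le> 1"
      if S: "finite S" "S \<subseteq> carrier G" and A: "A \<subseteq> X" and disj: "disjoint_family_on (\<lambda>g. \<phi> g ` A) S" for S A
    proof (rule \<nu>(5)[OF S])
      show "disjoint_family_on (\<lambda>g. g <#\<^bsub>G\<^esub> V A) S"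
        unfolding disjoint_family_on_def
      proof (intro ballI impI)
        fix g h assume gh: "g \<in> S" "h \<in> S" "g \<noteq> h"
        have "V (\<phi> g ` A) \<inter> V (\<phi> h ` A) = {}"
          using disj gh unfolding disjoint_family_on_def V_def by blast
        then show "(g <#\<^bsub>G\<^esub> V A) \<inter> (h <#\<^bsub>G\<^esub> V A) = {}"
          using V_image[OF _ A] gh S(2) by (metis subsetD)
      qed
    qed (auto simp: V_def)
  qed
qed

end

section \<open>Branches of small mass\<close>

lemma finite_separated:
  fixes F :: "'a::metric_space set"
  assumes "finite F"
  obtains \<rho> where "0 < \<rho>" "\<And>a b. \<lbrakk>a \<in> F; b \<in> F; a \<noteq> b\<rbrakk> \<Longrightarrow> \<rho> \<le> dist a b"
proof -
  define D where "D = insert 1 ((\<lambda>(a, b). dist a b) ` {p \<in> F \<times> F. fst p \<noteq> snd p})"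
  have D: "finite D" using assms by (auto simp: D_def)
  show thesis
  proof (rule that[of "Min D"])
    show "0 < Min D" using D by (auto simp: D_def)
    show "Min D \<le> dist a b" if "a \<in> F" "b \<in> F" "a \<noteq> b" for a b
      using D that by (intro Min_le) (force simp: D_def)+
  qed
qed

locale minimal_action_with_mass = minimal_dendrite_action X G \<phi> K
  for X :: "'a::metric_space set" and G :: "('g, 'm) monoid_scheme" (structure)
    and \<phi> :: "'g \<Rightarrow> 'a \<Rightarrow> 'a" and K :: "'a set" +
  fixes mass :: "'a set \<Rightarrow> real"
  assumes mass_K: "mass K = 1"
    and mass_Int_K: "mass (A \<inter> K) = mass A"
    and mass_mono: "A \<subseteq> B \<Longrightarrow> mass A \<le> mass B"
    and mass_Un: "mass (A \<union> B) \<le> mass A + mass B"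
    and mass_image: "\<lbrakk>g \<in> carrier G; A \<subseteq> X\<rbrakk> \<Longrightarrow> mass (\<phi> g ` A) = mass A"
    and mass_packing: "\<lbrakk>finite S; S \<subseteq> carrier G; A \<subseteq> X; disjoint_family_on (\<lambda>g. \<phi> g ` A) S\<rbrakk>
        \<Longrightarrow> real (card S) * mass A \<le> 1"
begin

text \<open>
  The translates of \<open>U\<close> cover \<open>K\<close> since all orbits are dense, so finitely many translates of the
  same mass suffice for total mass \<open>1\<close>.
\<close>

lemma mass_pos:
  assumes U: "openin (top_of_set X) U" and "U \<inter> K \<noteq> {}"
  shows "0 < mass U"
proof -
  have UX: "U \<subseteq> X" using U by (rule openin_imp_subset)
  have "\<forall>g\<in>carrier G. \<exists>T. open T \<and> \<phi> g ` U = X \<inter> T"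
    using openin_image[OF _ U] by (simp add: openin_open)
  then obtain T where T: "\<forall>g\<in>carrier G. open (T g) \<and> \<phi> g ` U = X \<inter> T g"
    by (rule bchoice[THEN exE])
  have "K \<subseteq> (\<Union>g\<in>carrier G. T g)"
  proof
    fix y assume y: "y \<in> K"
    then obtain g where g: "g \<in> carrier G" "\<phi> g y \<in> U"
      using orbit_meets_open[OF y U assms(2)] by blast
    have "y \<in> X" using y K_subset by blast
    then have "y = \<phi> (inv g) (\<phi> g y)" using g(1) by simp
    then have "y \<in> \<phi> (inv g) ` U" using g(2) by (rule image_eqI)
    then show "y \<in> (\<Union>g\<in>carrier G. T g)" using T g(1) inv_closed by blast
  qed
  then obtain S where S: "S \<subseteq> carrier G" "finite S" "K \<subseteq> (\<Union>g\<in>S. T g)"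
    using compactE_image[OF compact_K, of "carrier G" T] T by blast
  have "S \<noteq> {}" using S(3) K_nonempty by blast
  have "K \<subseteq> (\<Union>g\<in>S. X \<inter> T g)" using S(3) K_subset by blast
  also have "\<dots> = (\<Union>g\<in>S. \<phi> g ` U)" using S(1) T by (intro SUP_cong refl) auto
  finally have "K \<subseteq> (\<Union>g\<in>S. \<phi> g ` U)" .
  then have "1 \<le> mass (\<Union>g\<in>S. \<phi> g ` U)"
    using mass_mono[of K] mass_K by simp
  also have "\<dots> \<le> real (card S) * mass U"
    using S(2) \<open>S \<noteq> {}\<close> S(1)
  proof (induction S rule: finite_ne_induct)
    case (singleton g)
    then show ?case using mass_image[of g U] UX by simp
  next
    case (insert g S)
    have "mass (\<Union>h\<in>insert g S. \<phi> h ` U) \<le> mass (\<phi> g ` U) + mass (\<Union>h\<in>S. \<phi> h ` U)"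
      using mass_Un by simp
    also have "\<dots> \<le> mass U + real (card S) * mass U"
      using insert mass_image[of g U] UX by simp
    also have "\<dots> = real (card (insert g S)) * mass U"
      using insert by (simp add: algebra_simps)
    finally show ?case .
  qed
  finally have "0 < real (card S) * mass U" by simp
  then show ?thesis by (simp add: zero_less_mult_iff)
qed

text \<open>
  The orbit of \<open>y\<close> has \<open>n\<close> distinct points, and the corresponding translates of a sufficiently small
  ball at \<open>y\<close> are disjoint.
\<close>

lemma mass_small_ball:
  assumes "infinite K" and y: "y \<in> K" and "0 < c"
  obtains r where "0 < r" "mass (K \<inter> ball y r) < c"
proof -
  have yX: "y \<in> X" using y K_subset by blast
  obtain n where n: "0 < n" "1 / real n < c"
    using nat_approx_posE[OF \<open>0 < c\<close>] by (metis zero_less_Suc)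
  obtain F where F: "finite F" "card F = n" "F \<subseteq> (\<lambda>g. \<phi> g y) ` carrier G"
    using infinite_arbitrarily_large[OF infinite_orbit[OF assms(1) y]] by blast
  then obtain S where S: "S \<subseteq> carrier G" "inj_on (\<lambda>g. \<phi> g y) S" "F = (\<lambda>g. \<phi> g y) ` S"
    unfolding subset_image_inj by blast
  have finS: "finite S" and cardS: "card S = n"
    using F S by (simp add: finite_image_iff, simp add: card_image)
  have "S \<noteq> {}" using cardS n(1) by auto
  obtain \<rho> where \<rho>: "0 < \<rho>" "\<And>a b. \<lbrakk>a \<in> F; b \<in> F; a \<noteq> b\<rbrakk> \<Longrightarrow> \<rho> \<le> dist a b"
    using finite_separated[OF F(1)] by blast
  have "\<forall>g\<in>S. \<exists>r>0. \<forall>z\<in>X. dist z y < r \<longrightarrow> dist (\<phi> g z) (\<phi> g y) < \<rho> / 2"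
  proof
    fix g assume "g \<in> S"
    then have "continuous_on X (\<phi> g)"
      using \<phi>_homeomorphism S(1) by (auto simp: homeomorphism_def)
    then show "\<exists>r>0. \<forall>z\<in>X. dist z y < r \<longrightarrow> dist (\<phi> g z) (\<phi> g y) < \<rho> / 2"
      using yX \<rho>(1) unfolding continuous_on_iff by (metis half_gt_zero)
  qed
  then obtain r where r: "\<forall>g\<in>S. 0 < r g \<and> (\<forall>z\<in>X. dist z y < r g \<longrightarrow> dist (\<phi> g z) (\<phi> g y) < \<rho> / 2)"
    by (rule bchoice[THEN exE])
  define r0 where "r0 = Min (r ` S)"
  have r0: "0 < r0" "\<And>g. g \<in> S \<Longrightarrow> r0 \<le> r g"
    using finS \<open>S \<noteq> {}\<close> r by (auto simp: r0_def)
  define A where "A = K \<inter> ball y r0"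
  have A_img: "dist (\<phi> g z) (\<phi> g y) < \<rho> / 2" if "g \<in> S" "z \<in> A" for g z
    using that r r0(2)[OF that(1)] K_subset by (force simp: A_def dist_commute)
  have "disjoint_family_on (\<lambda>g. \<phi> g ` A) S"
    unfolding disjoint_family_on_def
  proof (intro ballI impI, rule ccontr)
    fix g h assume gh: "g \<in> S" "h \<in> S" "g \<noteq> h" "\<phi> g ` A \<inter> \<phi> h ` A \<noteq> {}"
    then obtain z w where zw: "z \<in> A" "w \<in> A" "\<phi> g z = \<phi> h w" by blast
    have "\<phi> g y \<noteq> \<phi> h y" using gh S(2) by (auto dest: inj_onD)
    then have "\<rho> \<le> dist (\<phi> g y) (\<phi> h y)" using \<rho>(2) gh S(3) by blast
    also have "\<dots> \<le> dist (\<phi> g z) (\<phi> g y) + dist (\<phi> h w) (\<phi> h y)"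
      using dist_triangle3[of "\<phi> g y" "\<phi> h y" "\<phi> g z"] zw(3) by (simp add: dist_commute)
    also have "\<dots> < \<rho>"
      using A_img[OF gh(1) zw(1)] A_img[OF gh(2) zw(2)] by simp
    finally show False by simp
  qed
  then have "real n * mass A \<le> 1"
    using mass_packing[OF finS S(1), of A] K_subset cardS by (auto simp: A_def)
  then have "mass A \<le> 1 / real n" using n(1) by (simp add: field_simps)
  with n(2) r0(1) show thesis by (intro that[of r0]) (auto simp: A_def)
qed

text \<open>
  True at the end point \<open>e\<close> of \<open>exists_branch_neighbourhoods\<close>, and carried to every point of \<open>K\<close> by
  the action.
\<close>

lemma branch_of_small_mass:
  assumes "infinite K" and y: "y \<in> K" and "0 < c"
  obtains H where "H \<in> branches" "y \<in> H" "mass H < c"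
proof -
  obtain e where e: "e \<in> K" "\<And>r. 0 < r \<Longrightarrow> \<exists>H\<in>branches. e \<in> H \<and> H \<inter> K \<subseteq> ball e r"
    using exists_branch_neighbourhoods[OF assms(1)] by metis
  obtain r where r: "0 < r" "mass (K \<inter> ball e r) < c"
    using mass_small_ball[OF assms(1) e(1) assms(3)] by blast
  obtain H where H: "H \<in> branches" "e \<in> H" "H \<inter> K \<subseteq> ball e r" using e(2)[OF r(1)] by blast
  have "mass H = mass (H \<inter> K)" by (rule mass_Int_K[symmetric])
  also have "\<dots> \<le> mass (K \<inter> ball e r)" using H(3) by (intro mass_mono) blast
  finally have mH: "mass H < c" using r(2) by simp
  have HX: "H \<subseteq> X" using openin_branches[OF H(1)] by (rule openin_imp_subset)
  have "H \<inter> K \<noteq> {}" using H(2) e(1) by blast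
  then obtain g where g: "g \<in> carrier G" "\<phi> g y \<in> H"
    using orbit_meets_open[OF y openin_branches[OF H(1)]] by blast
  have "y \<in> X" using y K_subset by blast
  then have "y = \<phi> (inv g) (\<phi> g y)" using g(1) by simp
  then have "y \<in> \<phi> (inv g) ` H" using g(2) by (rule image_eqI)
  moreover have "\<phi> (inv g) ` H \<in> branches" using g(1) H(1) by (intro branch_image) auto
  moreover have "mass (\<phi> (inv g) ` H) < c" using mass_image[OF _ HX] g(1) mH by simp
  ultimately show thesis by (intro that)
qed

text \<open>
  The mass of the branches of \<open>a\<close> and \<open>b\<close> at a point \<open>m\<close> between them bounds from below the mass of
  every branch that contains points close to \<open>a\<close> and points close to \<open>b\<close>.
\<close>

lemma small_mass_imp_small_branch:
  assumes "0 < \<epsilon>"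
  obtains \<delta> where "0 < \<delta>"
    "\<And>H u w. \<lbrakk>H \<in> branches; mass H < \<delta>; u \<in> H \<inter> K; w \<in> H \<inter> K\<rbrakk> \<Longrightarrow> dist u w < \<epsilon>"
proof -
  have "\<exists>\<delta>>0. \<forall>H u w. H \<in> branches \<and> mass H < \<delta> \<and> u \<in> H \<inter> K \<and> w \<in> H \<inter> K \<longrightarrow> dist u w < \<epsilon>"
  proof (rule ccontr)
    assume neg: "\<not> ?thesis"
    have "\<exists>H u w. H \<in> branches \<and> mass H < 1 / real (Suc n) \<and> u \<in> H \<inter> K \<and> w \<in> H \<inter> K \<and> \<epsilon> \<le> dist u w" for n
    proof (rule ccontr)
      assume "\<not> ?thesis"
      then have "\<forall>H u w. H \<in> branches \<and> mass H < 1 / real (Suc n) \<and> u \<in> H \<inter> K \<and> w \<in> H \<inter> K \<longrightarrow> dist u w < \<epsilon>"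
        by (meson not_le)
      moreover have "0 < 1 / real (Suc n)" by simp
      ultimately show False using neg by blast
    qed
    then obtain H u w where *: "\<And>n. H n \<in> branches \<and> mass (H n) < 1 / real (Suc n) \<and>
        u n \<in> H n \<inter> K \<and> w n \<in> H n \<inter> K \<and> \<epsilon> \<le> dist (u n) (w n)"
      by metis
    have "seq_compact (K \<times> K)" using compact_imp_seq_compact compact_Times compact_K by blast
    moreover have "\<forall>n. (u n, w n) \<in> K \<times> K" using * by blast
    ultimately obtain l r where l: "l \<in> K \<times> K" "strict_mono r" "((\<lambda>n. (u n, w n)) \<circ> r) \<longlonglongrightarrow> l"
      by (rule seq_compactE)
    define a b where "a = fst l" and "b = snd l"
    have ab: "a \<in> K" "b \<in> K" using l(1) by (auto simp: a_def b_def)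
    have ua: "(\<lambda>n. u (r n)) \<longlonglongrightarrow> a" and wb: "(\<lambda>n. w (r n)) \<longlonglongrightarrow> b"
      using tendsto_fst[OF l(3)] tendsto_snd[OF l(3)] by (simp_all add: a_def b_def o_def)
    have "(\<lambda>n. dist (u (r n)) (w (r n))) \<longlonglongrightarrow> dist a b" using ua wb by (rule tendsto_dist)
    then have "\<epsilon> \<le> dist a b" by (rule LIMSEQ_le_const) (use * in blast)
    then have "a \<noteq> b" using assms by auto
    then obtain m where m: "m \<in> X - {a, b}" "b \<notin> branch m a"
      using cut_point_between[of a b] ab K_subset by blast
    have am: "a \<in> X - {m}" and bm: "b \<in> X - {m}" using m ab K_subset by auto
    have disj: "branch m a \<inter> branch m b = {}"
      using m(2) connected_component_disjoint[of "X - {m}" b a] by blast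
    have ev: "\<forall>\<^sub>F n in sequentially. v (r n) \<in> branch m x"
      if "(\<lambda>n. v (r n)) \<longlonglongrightarrow> x" "x \<in> X - {m}" "\<And>n. v n \<in> K" for v x
    proof -
      obtain T where T: "open T" "branch m x = X \<inter> T"
        using openin_branch[of m x] unfolding openin_open by blast
      have "x \<in> T" using branch_self[OF that(2)] T(2) by blast
      with that(1) T(1) have "\<forall>\<^sub>F n in sequentially. v (r n) \<in> T"
        by (rule topological_tendstoD)
      then show ?thesis
        by (rule eventually_mono) (use T(2) that(3) K_subset in blast)
    qed
    define \<mu> where "\<mu> = min (mass (branch m a)) (mass (branch m b))"
    have "0 < mass (branch m a)" "0 < mass (branch m b)"
      using mass_pos[OF openin_branch] branch_self[OF am] branch_self[OF bm] ab by blast+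
    then have "0 < \<mu>" by (simp add: \<mu>_def)
    then obtain N where N: "1 / real (Suc N) < \<mu>" using nat_approx_posE by blast
    have "\<forall>\<^sub>F n in sequentially. u (r n) \<in> branch m a"
      using ev[OF ua am] * by blast
    moreover have "\<forall>\<^sub>F n in sequentially. w (r n) \<in> branch m b"
      using ev[OF wb bm] * by blast
    moreover have "\<forall>\<^sub>F n in sequentially. N \<le> n" by (rule eventually_ge_at_top)
    ultimately have "\<forall>\<^sub>F n in sequentially. u (r n) \<in> branch m a \<and> w (r n) \<in> branch m b \<and> N \<le> n"
      by eventually_elim blast
    then obtain n where n: "u (r n) \<in> branch m a" "w (r n) \<in> branch m b" "N \<le> n"
      using eventually_happens by fastforce
    let ?H = "H (r n)"
    have H: "?H \<in> branches" "u (r n) \<in> ?H" "w (r n) \<in> ?H" using * by blast+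
    obtain c x where cx: "c \<in> X" "x \<in> X - {c}" "?H = branch c x"
      using H(1) unfolding branches_iff by blast
    \<comment> \<open>A connected set that meets two branches at \<open>m\<close> passes through \<open>m\<close>.\<close>
    have "m \<in> ?H"
    proof (rule connected_meets_cut_point)
      show "connected ?H" "?H \<subseteq> X" unfolding cx(3) using branch_subset by auto
      show "w (r n) \<notin> branch m a" using n(2) disj by blast
    qed (use H n in auto)
    then have mH: "m \<in> branch c x" unfolding cx(3) .
    \<comment> \<open>The centre \<open>c\<close> lies in at most one of the two branches at \<open>m\<close>; the other one is absorbed.\<close>
    have "branch m a \<subseteq> ?H \<or> branch m b \<subseteq> ?H"
      using disj branch_absorbs_branch[OF mH am] branch_absorbs_branch[OF mH bm] unfolding cx(3) by blast
    then have "\<mu> \<le> mass ?H" unfolding \<mu>_def using mass_mono by (meson min.coboundedI1 min.coboundedI2)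
    also have "\<dots> < 1 / real (Suc (r n))" using * by blast
    also have "\<dots> \<le> 1 / real (Suc N)"
    proof -
      have "N \<le> r n" using n(3) seq_suble[OF l(2), of n] by simp
      then show ?thesis by (intro divide_left_mono) auto
    qed
    finally show False using N by simp
  qed
  then show thesis using that by blast
qed

text \<open>
  A branch of small mass around \<open>m \<in> K\<close> would contain a whole branch at \<open>m\<close> of \<open>y\<close> or of \<open>z\<close>, although
  its trace on \<open>K\<close> is too small to reach either point.
\<close>

lemma cut_point_notin:
  assumes "infinite K" and yz: "y \<in> K" "z \<in> K" and m: "m \<in> X - {y, z}" "z \<notin> branch m y"
  shows "m \<notin> K"
proof
  assume mK: "m \<in> K"
  define \<epsilon> where "\<epsilon> = min (dist m y) (dist m z)"
  have "0 < \<epsilon>" using m(1) by (auto simp: \<epsilon>_def)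
  then obtain \<delta> where \<delta>: "0 < \<delta>"
    "\<And>H u w. \<lbrakk>H \<in> branches; mass H < \<delta>; u \<in> H \<inter> K; w \<in> H \<inter> K\<rbrakk> \<Longrightarrow> dist u w < \<epsilon>"
    using small_mass_imp_small_branch by blast
  obtain H where H: "H \<in> branches" "m \<in> H" "mass H < \<delta>"
    using branch_of_small_mass[OF assms(1) mK \<delta>(1)] by blast
  have out: "v \<notin> H" if "v \<in> {y, z}" for v
  proof
    assume "v \<in> H"
    then have "dist m v < \<epsilon>" using \<delta>(2)[OF H(1,3), of m v] H(2) mK that yz by blast
    moreover have "\<epsilon> \<le> dist m v" using that by (auto simp: \<epsilon>_def)
    ultimately show False by simp
  qed
  obtain c x where cx: "c \<in> X" "x \<in> X - {c}" "H = branch c x"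
    using H(1) unfolding branches_iff by blast
  have ym: "y \<in> X - {m}" and zm: "z \<in> X - {m}" using m(1) yz K_subset by auto
  have mH: "m \<in> branch c x" using H(2) cx(3) by simp
  have "branch m y \<inter> branch m z = {}"
    using m(2) connected_component_disjoint[of "X - {m}" z y] by blast
  then have "branch m y \<subseteq> H \<or> branch m z \<subseteq> H"
    using branch_absorbs_branch[OF mH ym] branch_absorbs_branch[OF mH zm] unfolding cx(3) by blast
  then show False using out branch_self[OF ym] branch_self[OF zm] by blast
qed

lemma clopen_separation:
  assumes "infinite K" and yz: "y \<in> K" "z \<in> K" "y \<noteq> z"
  shows "\<exists>C. clopenin K C \<and> y \<in> C \<and> z \<notin> C"
proof -
  obtain m where m: "m \<in> X - {y, z}" "z \<notin> branch m y"
    using cut_point_between[of y z] yz K_subset by blast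
  have "m \<notin> K" by (rule cut_point_notin[OF assms(1) yz(1,2) m])
  then have eq: "K \<inter> branch m y = K \<inter> insert m (branch m y)" by blast
  have "openin (top_of_set K) (K \<inter> branch m y)"
  proof (rule openin_subtopology_Int_subset[OF _ K_subset])
    have "X \<inter> branch m y = branch m y" using branch_subset by blast
    then show "openin (top_of_set X) (X \<inter> branch m y)" using openin_branch by simp
  qed
  moreover have "closedin (top_of_set K) (K \<inter> branch m y)"
    unfolding eq using closed_insert_branch m(1) by (intro closedin_closed_Int) auto
  ultimately show ?thesis
    using m yz K_subset branch_self[of y m]
    by (intro exI[of _ "K \<inter> branch m y"]) (auto simp: clopenin_def)
qed

lemma infinite_equicontinuous:
  assumes "infinite K" and "0 < \<epsilon>"
  obtains \<delta> where "0 < \<delta>" "\<And>x y g. \<lbrakk>x \<in> K; y \<in> K; dist x y < \<delta>; g \<in> carrier G\<rbrakk> \<Longrightarrow> dist (\<phi> g x) (\<phi> g y) < \<epsilon>"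
proof -
  obtain \<eta> where \<eta>: "0 < \<eta>"
    "\<And>H u w. \<lbrakk>H \<in> branches; mass H < \<eta>; u \<in> H \<inter> K; w \<in> H \<inter> K\<rbrakk> \<Longrightarrow> dist u w < \<epsilon>"
    using small_mass_imp_small_branch[OF assms(2)] by blast
  define \<T> where "\<T> = {T. open T \<and> X \<inter> T \<in> branches \<and> mass (X \<inter> T) < \<eta>}"
  have "K \<subseteq> \<Union>\<T>"
  proof
    fix y assume "y \<in> K"
    then obtain H where H: "H \<in> branches" "y \<in> H" "mass H < \<eta>"
      using branch_of_small_mass[OF assms(1) _ \<eta>(1)] by blast
    then obtain T where "open T" "H = X \<inter> T"
      using openin_branches unfolding openin_open by blast
    then show "y \<in> \<Union>\<T>" using H unfolding \<T>_def by blast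
  qed
  then obtain \<delta> where \<delta>: "0 < \<delta>" "\<And>x. x \<in> K \<Longrightarrow> \<exists>T\<in>\<T>. ball x \<delta> \<subseteq> T"
    using Heine_Borel_lemma[OF compact_K, of \<T>] unfolding \<T>_def by blast
  show thesis
  proof (rule that[OF \<delta>(1)])
    fix x y g assume xy: "x \<in> K" "y \<in> K" "dist x y < \<delta>" and g: "g \<in> carrier G"
    obtain T where T: "X \<inter> T \<in> branches" "mass (X \<inter> T) < \<eta>" "ball x \<delta> \<subseteq> T"
      using \<delta>(2)[OF xy(1)] unfolding \<T>_def by blast
    have "x \<in> ball x \<delta>" "y \<in> ball x \<delta>" using xy(3) \<delta>(1) by auto
    then have xyT: "x \<in> X \<inter> T" "y \<in> X \<inter> T" using T(3) xy(1,2) K_subset by blast+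
    show "dist (\<phi> g x) (\<phi> g y) < \<epsilon>"
    proof (rule \<eta>(2))
      show "\<phi> g ` (X \<inter> T) \<in> branches" using g T(1) by (rule branch_image)
      show "mass (\<phi> g ` (X \<inter> T)) < \<eta>" using mass_image[OF g] T(2) by simp
    qed (use xyT \<phi>_K[OF g] xy in blast)+
  qed
qed

end

section \<open>Equicontinuity and the structure of minimal sets\<close>

theorem theorem1p1:
  fixes G :: "('g, 'm) monoid_scheme"
    and X K :: "'a::metric_space set"
    and \<phi> :: "'g \<Rightarrow> 'a \<Rightarrow> 'a"
  assumes "group G" and "countable (carrier G)" and "amenable G"
    and "dendrite X"
    and "homeo_action G X \<phi>"
    and "minimal_set G X \<phi> K"
  shows "equicontinuous_action G K (restrict_action \<phi> K)
       \<and> (finite K \<or> K homeomorphic cantor_set)"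
proof (cases "finite K")
  case True
  obtain \<rho> where \<rho>: "0 < \<rho>" "\<And>a b. \<lbrakk>a \<in> K; b \<in> K; a \<noteq> b\<rbrakk> \<Longrightarrow> \<rho> \<le> dist a b"
    using finite_separated[OF True] by blast
  have "equicontinuous_action G K (restrict_action \<phi> K)"
    unfolding equicontinuous_action_def
    using \<rho> by (metis dist_self not_le)
  with True show ?thesis by blast
next
  case False
  interpret minimal_dendrite_action X G \<phi> K
    using assms(1,4-6)
    by (intro minimal_dendrite_action.intro dendrite_space.intro minimal_dendrite_action_axioms.intro)
  obtain mass :: "'a set \<Rightarrow> real" where "minimal_action_with_mass X G \<phi> K mass"
  proof (rule exists_invariant_mass[OF assms(3)])
    fix mass :: "'a set \<Rightarrow> real"
    assume "mass K = 1" "\<And>A. mass (A \<inter> K) = mass A"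
      "\<And>A B. A \<subseteq> B \<Longrightarrow> mass A \<le> mass B"
      "\<And>A B. mass (A \<union> B) \<le> mass A + mass B"
      "\<And>g A. \<lbrakk>g \<in> carrier G; A \<subseteq> X\<rbrakk> \<Longrightarrow> mass (\<phi> g ` A) = mass A"
      "\<And>S A. \<lbrakk>finite S; S \<subseteq> carrier G; A \<subseteq> X; disjoint_family_on (\<lambda>g. \<phi> g ` A) S\<rbrakk>
        \<Longrightarrow> real (card S) * mass A \<le> 1"
    then have "minimal_action_with_mass X G \<phi> K mass" by unfold_locales
    then show thesis by (rule that)
  qed
  interpret minimal_action_with_mass X G \<phi> K mass by fact
  have "equicontinuous_action G K (restrict_action \<phi> K)"
    unfolding equicontinuous_action_def restrict_action_def
  proof (intro allI impI)
    fix \<epsilon> :: real assume "0 < \<epsilon>"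
    then obtain \<delta> where "0 < \<delta>"
      "\<And>x y g. \<lbrakk>x \<in> K; y \<in> K; dist x y < \<delta>; g \<in> carrier G\<rbrakk> \<Longrightarrow> dist (\<phi> g x) (\<phi> g y) < \<epsilon>"
      using infinite_equicontinuous[OF False] by blast
    then show "\<exists>\<delta>>0. \<forall>x\<in>K. \<forall>y\<in>K. dist x y < \<delta> \<longrightarrow>
        (\<forall>g\<in>carrier G. dist (restrict (\<phi> g) K x) (restrict (\<phi> g) K y) < \<epsilon>)"
      by (intro exI[of _ \<delta>]) auto
  qed
  moreover have "K homeomorphic cantor_set"
    using compact_K K_nonempty isolated_imp_finite False clopen_separation[OF False]
    by (intro homeomorphic_cantor_set) auto
  ultimately show ?thesis by blast
qed

end
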